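(* Let $T$ be a reflexive tree and let $\phi:E(T)\to\mathbb{Z}$ be an assignment of integers to the edges of $T$ that is positive on every loop. Suppose there is a vertex $v\in V(T)$ such that $\phi(u)=\phi(v)$ for every neighbor $u$ of $v$. Then there exists $N$ such that for every prime $p\ge N$, the covering graph $T^{\sigma}$ (with $\sigma$ the voltage assignment into $\mathbb{Z}_p$ induced by $\phi$) is Hamiltonian.
   Context: A reflexive tree is a tree with exactly one loop added at every vertex; $\phi(w)$ denotes the integer assigned to the loop at $w$. For a prime $p$, the voltage assignment $\sigma$ into $\mathbb{Z}_p$ is defined by giving each edge $e$ a fixed orientation with arcs $e^+,e^-$ (for a loop, the primary and secondary arc) and setting $\sigma(e^+)=\phi(e)\bmod p$, $\sigma(e^-)=-\phi(e)\bmod p$. The lift $T^\sigma$ has vertex set $V(T)\times\mathbb{Z}_p$, with $(u,a)$ adjacent to $(w,b)$ iff some arc $(u,w)$ has $\sigma(u,w)=b-a$. *)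

theory Defs
  imports "Graph_Theory.Graph_Theory" "HOL-Computational_Algebra.Primes"
begin

text \<open>
  An undirected multigraph, loops allowed, together with a fixed orientation of its edges is
  represented by a \<^typ>\<open>('v, 'e) pre_digraph\<close> whose arcs are the \<^emph>\<open>edges\<close>: the edge \<open>e\<close> is
  oriented from \<open>tail G e\<close> to \<open>head G e\<close>. Its two arcs are \<open>(e, True)\<close>, standing for \<open>e\<^sup>+\<close>, and
  \<open>(e, False)\<close>, standing for \<open>e\<^sup>-\<close>. They are distinct also if \<open>e\<close> is a loop.
\<close>

definition dart_graph :: "('v, 'e) pre_digraph \<Rightarrow> ('v, 'e \<times> bool) pre_digraph" where
  "dart_graph G = \<lparr>
     verts = verts G,
     arcs = arcs G \<times> UNIV,
     tail = (\<lambda>(e, s). if s then tail G e else head G e),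
     head = (\<lambda>(e, s). if s then head G e else tail G e) \<rparr>"

definition neighbor :: "('v, 'e) pre_digraph \<Rightarrow> 'v \<Rightarrow> 'v \<Rightarrow> bool" where
  "neighbor G u w \<longleftrightarrow> u \<rightarrow>\<^bsub>dart_graph G\<^esub> w"

text \<open>
  The library constant \<^const>\<open>tree\<close> excludes directed cycles only, hence it is neither the
  notion of a tree for an orientation of a graph nor for a symmetric digraph. Here a cycle may
  traverse edges in both directions, but no edge twice; loops and pairs of parallel edges are
  cycles of length 1 and 2.
\<close>

definition undirected_cycle :: "('v, 'e) pre_digraph \<Rightarrow> ('e \<times> bool) awalk \<Rightarrow> bool" where
  "undirected_cycle G c \<longleftrightarrow> pre_digraph.cycle (dart_graph G) c \<and> distinct (map fst c)"

definition undirected_tree :: "('v, 'e) pre_digraph \<Rightarrow> bool" where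
  "undirected_tree G \<longleftrightarrow> fin_digraph G \<and> connected G \<and> (\<nexists>c. undirected_cycle G c)"

definition loops :: "('v, 'e) pre_digraph \<Rightarrow> 'e set" where
  "loops G = {e \<in> arcs G. tail G e = head G e}"

definition reflexive_tree :: "('v, 'e) pre_digraph \<Rightarrow> bool" where
  "reflexive_tree T \<longleftrightarrow>
     undirected_tree (T\<lparr>arcs := arcs T - loops T\<rparr>) \<and>
     tail T ` loops T \<subseteq> verts T \<and>
     (\<forall>w \<in> verts T. \<exists>!e. e \<in> loops T \<and> tail T e = w)"

definition loop_at :: "('v, 'e) pre_digraph \<Rightarrow> 'v \<Rightarrow> 'e" where
  "loop_at T w = (THE e. e \<in> loops T \<and> tail T e = w)"

text \<open>The group \<open>\<int>\<^sub>p\<close> is represented by the residues \<^term>\<open>{0..<int p}\<close>.\<close>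

definition voltage :: "('e \<Rightarrow> int) \<Rightarrow> nat \<Rightarrow> 'e \<times> bool \<Rightarrow> int" where
  "voltage \<phi> p = (\<lambda>(e, s). (if s then \<phi> e else - \<phi> e) mod int p)"

text \<open>
  The lift, as a symmetric digraph without parallel arcs, for a voltage assignment \<open>\<sigma>\<close> into
  \<open>\<int>\<^sub>p\<close>.
\<close>

definition lift :: "('v, 'e) pre_digraph \<Rightarrow> nat \<Rightarrow> ('e \<times> bool \<Rightarrow> int) \<Rightarrow> ('v \<times> int) pair_pre_digraph"
  where
  "lift T p \<sigma> = \<lparr>
     pverts = verts T \<times> {0..<int p},
     parcs = {((u, a), (w, b)) | u a w b.
       a \<in> {0..<int p} \<and> b \<in> {0..<int p} \<and>
       (\<exists>x \<in> arcs (dart_graph T).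
          tail (dart_graph T) x = u \<and> head (dart_graph T) x = w \<and> \<sigma> x = (b - a) mod int p)} \<rparr>"

lemma symmetric_lift: "symmetric (with_proj (lift T p (voltage \<phi> p)))"
proof -
  have "((w, b), (u, a)) \<in> parcs (lift T p (voltage \<phi> p))"
    if uw: "((u, a), (w, b)) \<in> parcs (lift T p (voltage \<phi> p))" for u a w b
  proof -
    from uw obtain e s where *: "e \<in> arcs T" "a \<in> {0..<int p}" "b \<in> {0..<int p}"
      "(if s then tail T e else head T e) = u" "(if s then head T e else tail T e) = w"
      "(if s then \<phi> e else - \<phi> e) mod int p = (b - a) mod int p"
      by (auto simp: lift_def dart_graph_def voltage_def)
    have "(if \<not> s then \<phi> e else - \<phi> e) mod int p = (a - b) mod int p"
      using mod_minus_cong[OF *(6)] by (auto split: if_splits)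
    then have "\<exists>x \<in> arcs (dart_graph T). tail (dart_graph T) x = w \<and> head (dart_graph T) x = u
        \<and> voltage \<phi> p x = (a - b) mod int p"
      using * by (intro bexI[of _ "(e, \<not> s)"]) (auto simp: dart_graph_def voltage_def)
    then show ?thesis
      using * by (auto simp: lift_def)
  qed
  then show ?thesis
    by (auto simp: symmetric_def arcs_ends_def arc_to_ends_def sym_def with_proj_def)
qed

text \<open>
  For a symmetric digraph without parallel arcs, representing an undirected graph. The bound on
  the length excludes traversing one edge back and forth.
\<close>

definition hamiltonian :: "('v, 'a) pre_digraph \<Rightarrow> bool" where
  "hamiltonian G \<longleftrightarrow> (\<exists>c. pre_digraph.cycle G c \<and> 3 \<le> length c \<and> tail G ` set c = verts G)"

end

theory Submission
  imports Defs
begin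

text \<open>
  The lift contains over every vertex \<open>w\<close> the fiber cycle with step \<open>\<phi>(w)\<close>,
  and over every tree edge a perfect matching of two fibers. Starting from the fiber cycles, a two-factor of
  the lift of a rooted subtree is built bottom-up by switches; the two-factor of a branch may be rotated
  arbitrarily before it is attached. If the steps of the two vertices agree, a component is merged by
  exchanging two parallel fiber edges for two matching edges, and no component is ever split. If the steps
  are \<open>c \<noteq> d\<close>, one uses the octagon that consists of the edges from \<open>0\<close> to
  \<open>c\<close> and from \<open>d\<close> to \<open>c + d\<close> in one fiber, from \<open>0\<close> to
  \<open>d\<close> and from \<open>c\<close> to \<open>c + d\<close> in the other one, and of the matching
  edges at \<open>0\<close>, \<open>c\<close>, \<open>d\<close>, \<open>c + d\<close>. This switch may split
  components, but each component it touches still passes through the root fiber near the switch. So there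
  remains a bounded number of places in the root fiber that meet all components, which suffices to attach
  the branch to its parent. All branches at \<open>v\<close> have the step of \<open>v\<close> at their
  roots, hence the last two-factor is connected.
\<close>

section \<open>Two-factors and switches\<close>

text \<open>Undirected subgraphs are symmetric relations: components are classes of
  \<open>r\<^sup>*\<close>, degrees are cardinalities of images. Such an \<open>r\<close> is a
  disjoint union of cycles covering \<open>A\<close>.\<close>

definition two_factor :: "'a rel \<Rightarrow> 'a set \<Rightarrow> 'a rel \<Rightarrow> bool" where
  "two_factor E A r \<longleftrightarrow> finite A \<and> r \<subseteq> E \<and> r \<subseteq> A \<times> A \<and> sym r \<and> irrefl r \<and> (\<forall>z \<in> A. card (r `` {z}) = 2)"

lemma two_factorD:
  assumes "two_factor E A r"
  shows "finite A" "r \<subseteq> E" "r \<subseteq> A \<times> A" "sym r" "irrefl r" "finite r"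
    "\<And>z. z \<in> A \<Longrightarrow> card (r `` {z}) = 2" "\<And>z. finite (r `` {z})"
proof -
  show *: "finite A" "r \<subseteq> A \<times> A" "r \<subseteq> E" "sym r" "irrefl r" "\<And>z. z \<in> A \<Longrightarrow> card (r `` {z}) = 2"
    using assms by (auto simp: two_factor_def)
  then show "finite r" using finite_subset by blast
  then show "finite (r `` {z})" for z by (rule finite_Image)
qed

lemma two_factor_Un:
  assumes r: "two_factor E A r" and r': "two_factor E B r'" and disj: "A \<inter> B = {}"
  shows "two_factor E (A \<union> B) (r \<union> r')"
proof -
  note D = two_factorD[OF r] and D' = two_factorD[OF r']
  have "(r \<union> r') `` {z} = r `` {z}" if "z \<in> A" for z using that D'(3) disj by blast
  moreover have "(r \<union> r') `` {z} = r' `` {z}" if "z \<in> B" for z using that D(3) disj by blast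
  ultimately show ?thesis
    using D D' by (auto simp: two_factor_def intro!: sym_Un) (auto simp: irrefl_def)
qed

lemma two_factor_image:
  assumes r: "two_factor E A r" and inj: "inj_on h A"
    and E: "\<And>y z. (y, z) \<in> E \<Longrightarrow> (h y, h z) \<in> E"
  shows "two_factor E (h ` A) (map_prod h h ` r)"
proof -
  note D = two_factorD[OF r]
  have hr: "(h y, z) \<in> map_prod h h ` r \<longleftrightarrow> (\<exists>x. z = h x \<and> (y, x) \<in> r)" if "y \<in> A" for y z
  proof
    assume "(h y, z) \<in> map_prod h h ` r"
    then obtain y' x where *: "h y = h y'" "z = h x" "(y', x) \<in> r" by auto
    then have "y = y'" using D(3) inj that by (auto dest: inj_onD)
    then show "\<exists>x. z = h x \<and> (y, x) \<in> r" using * by blast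
  qed (auto intro: rev_image_eqI)
  have "card ((map_prod h h ` r) `` {h z}) = 2" if "z \<in> A" for z
  proof -
    have "(map_prod h h ` r) `` {h z} = h ` (r `` {z})"
      by (auto simp only: set_eq_iff Image_singleton_iff hr[OF that])
    moreover have "inj_on h (r `` {z})" using D(3) by (intro inj_on_subset[OF inj]) auto
    ultimately show ?thesis using D(7)[OF that] by (simp add: card_image)
  qed
  moreover have "sym (map_prod h h ` r)"
  proof (rule symI)
    fix a b assume "(a, b) \<in> map_prod h h ` r"
    then obtain y z where "a = h y" "b = h z" "(y, z) \<in> r" by auto
    then show "(b, a) \<in> map_prod h h ` r" using D(4) by (auto dest: symD intro: rev_image_eqI)
  qed
  moreover have "irrefl (map_prod h h ` r)"
  proof (rule irreflI)
    fix a show "(a, a) \<notin> map_prod h h ` r"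
    proof
      assume "(a, a) \<in> map_prod h h ` r"
      then obtain y z where yz: "a = h y" "a = h z" "(y, z) \<in> r"
        by (elim imageE) (metis Pair_inject map_prod_simp surj_pair)
      then have "y = z" using D(3) inj by (auto dest: inj_onD)
      then show False using yz D(5) by (auto simp: irrefl_def)
    qed
  qed
  ultimately show ?thesis
    using D(1-3) E unfolding two_factor_def by auto
qed

text \<open>For symmetric \<open>r\<close> every component on \<open>A\<close> meets
  \<open>W\<close>. Connectedness is tracked only through such sets \<open>W\<close>.\<close>

definition spans :: "'a rel \<Rightarrow> 'a set \<Rightarrow> 'a set \<Rightarrow> bool" where
  "spans r A W \<longleftrightarrow> (\<forall>z \<in> A. \<exists>t \<in> W. (z, t) \<in> r\<^sup>*)"

lemma spans_trans:
  assumes "spans r A W" "spans r W W'"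
  shows "spans r A W'"
  using assms unfolding spans_def by (meson rtrancl_trans)

lemma spans_mono:
  assumes "spans r A W" "r\<^sup>* \<subseteq> r'\<^sup>*" "W \<subseteq> W'"
  shows "spans r' A W'"
  using assms unfolding spans_def by blast

definition sym_pairs :: "('a \<times> 'a) list \<Rightarrow> 'a rel" where
  "sym_pairs ps = set ps \<union> (set ps)\<inverse>"

text \<open>A list rather than a set, so that \<open>distinct (ends ps)\<close> says that the pairs
  are no loops and form a matching.\<close>

definition ends :: "('a \<times> 'a) list \<Rightarrow> 'a list" where
  "ends ps = map fst ps @ map snd ps"

lemma sym_sym_pairs: "sym (sym_pairs ps)"
  by (auto simp: sym_pairs_def sym_def)

lemma sym_pairs_subset_iff: "sym r \<Longrightarrow> sym_pairs ps \<subseteq> r \<longleftrightarrow> set ps \<subseteq> r"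
  by (auto simp: sym_pairs_def sym_def)

lemma sym_pairs_ends: "(y, z) \<in> sym_pairs ps \<Longrightarrow> y \<in> set (ends ps) \<and> z \<in> set (ends ps)"
  by (force simp: sym_pairs_def ends_def)

lemma card_sym_pairs_Image:
  assumes "distinct (ends ps)"
  shows "card (sym_pairs ps `` {z}) = (if z \<in> set (ends ps) then 1 else 0)"
  using assms
proof (induction ps)
  case Nil
  then show ?case by (simp add: sym_pairs_def ends_def)
next
  case (Cons q ps)
  obtain a b where q: "q = (a, b)" by fastforce
  have ab: "a \<notin> set (ends ps)" "b \<notin> set (ends ps)" "a \<noteq> b" "distinct (ends ps)"
    using Cons.prems by (auto simp: q ends_def)
  have eq: "sym_pairs (q # ps) = {(a, b), (b, a)} \<union> sym_pairs ps"
    by (auto simp: sym_pairs_def q)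
  have no: "sym_pairs ps `` {z} = {}" if "z \<notin> set (ends ps)" for z
    using that sym_pairs_ends by fastforce
  have en: "set (ends (q # ps)) = {a, b} \<union> set (ends ps)" by (auto simp: ends_def q)
  consider "z = a" | "z = b" | "z \<noteq> a" "z \<noteq> b" by blast
  then show ?case
  proof cases
    case 1
    then have "sym_pairs (q # ps) `` {z} = {b}" using no[of a] ab by (auto simp: eq)
    with 1 show ?thesis by (simp add: en)
  next
    case 2
    then have "sym_pairs (q # ps) `` {z} = {a}" using no[of b] ab by (auto simp: eq)
    with 2 show ?thesis by (simp add: en)
  next
    case 3
    then have "sym_pairs (q # ps) `` {z} = sym_pairs ps `` {z}" by (auto simp: eq)
    with 3 Cons.IH ab(4) show ?thesis by (simp add: en)
  qed
qed

definition switch :: "'a rel \<Rightarrow> ('a \<times> 'a) list \<Rightarrow> ('a \<times> 'a) list \<Rightarrow> 'a rel" where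
  "switch r ps qs = r - sym_pairs ps \<union> sym_pairs qs"

text \<open>Both lists are matchings on the same vertices, so each of these loses one edge and gains
  one; the gain is genuine because \<open>qs\<close> avoids \<open>r\<close>.\<close>

lemma two_factor_switch:
  assumes r: "two_factor E A r" and "sym E"
    and ps: "set ps \<subseteq> r" "distinct (ends ps)"
    and qs: "set qs \<subseteq> E" "distinct (ends qs)" "set qs \<inter> r = {}"
    and ends: "set (ends ps) = set (ends qs)"
  shows "two_factor E A (switch r ps qs)"
proof -
  note D = two_factorD[OF r]
  have ps': "sym_pairs ps \<subseteq> r" using ps D(4) by (simp add: sym_pairs_subset_iff)
  have qs': "sym_pairs qs \<subseteq> E" using qs \<open>sym E\<close> by (simp add: sym_pairs_subset_iff)
  have qr: "sym_pairs qs \<inter> r = {}"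
    using qs(3) D(4) by (auto simp: sym_pairs_def sym_def)
  have eA: "set (ends ps) \<subseteq> A" using ps(1) D(3) by (force simp: ends_def)
  have qA: "sym_pairs qs \<subseteq> A \<times> A" using sym_pairs_ends[of _ _ qs] ends eA by fastforce
  have irq: "(z, z) \<notin> sym_pairs qs" for z
    using qs(2) by (auto simp: sym_pairs_def ends_def image_iff distinct_map) force+
  have "card (switch r ps qs `` {z}) = 2" if "z \<in> A" for z
  proof -
    have eq: "switch r ps qs `` {z} = (r `` {z} - sym_pairs ps `` {z}) \<union> sym_pairs qs `` {z}"
      by (auto simp: switch_def)
    have fin: "finite (sym_pairs qs)" by (simp add: sym_pairs_def)
    have "card (switch r ps qs `` {z}) = card (r `` {z} - sym_pairs ps `` {z}) + card (sym_pairs qs `` {z})"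
      unfolding eq using D(8) fin qr by (intro card_Un_disjoint) auto
    also have "card (r `` {z} - sym_pairs ps `` {z}) = card (r `` {z}) - card (sym_pairs ps `` {z})"
      using ps' D(8) by (intro card_Diff_subset) (auto intro: finite_subset)
    finally show ?thesis
      using D(7)[OF that] card_sym_pairs_Image[OF ps(2), of z] card_sym_pairs_Image[OF qs(2), of z] ends
      by auto
  qed
  moreover have "sym (switch r ps qs)"
    using D(4) sym_sym_pairs[of ps] sym_sym_pairs[of qs] by (auto simp: switch_def sym_def)
  ultimately show ?thesis
    using D irq qA qs' by (auto simp: two_factor_def switch_def irrefl_def)
qed

text \<open>A path in \<open>r\<close> towards \<open>W\<close> either survives or can be stopped at
  its first removed edge, at an end of that edge.\<close>

lemma spans_switch:
  assumes "spans r A W"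
  shows "spans (switch r ps qs) A (W \<union> set (ends ps))"
  unfolding spans_def
proof
  fix z assume "z \<in> A"
  then obtain t where t: "t \<in> W" "(z, t) \<in> r\<^sup>*" using assms by (auto simp: spans_def)
  from t(2) show "\<exists>t\<in>W \<union> set (ends ps). (z, t) \<in> (switch r ps qs)\<^sup>*"
  proof (induction rule: converse_rtrancl_induct)
    case base
    then show ?case using t by blast
  next
    case (step y z)
    show ?case
    proof (cases "(y, z) \<in> sym_pairs ps")
      case True
      then show ?thesis using sym_pairs_ends by fastforce
    next
      case False
      then have "(y, z) \<in> switch r ps qs" using step by (auto simp: switch_def)
      then show ?thesis using step by (meson converse_rtrancl_into_rtrancl)
    qed
  qed
qed

text \<open>Handshake lemma: the ordered pairs come in couples \<open>(a, b)\<close>,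
  \<open>(b, a)\<close>.\<close>

lemma even_card_sym_irrefl:
  assumes "finite r" "sym r" "irrefl r"
  shows "even (card r)"
  using assms
proof (induction "card r" arbitrary: r rule: less_induct)
  case less
  show ?case
  proof (cases "r = {}")
    case False
    then obtain a b where ab: "(a, b) \<in> r" by auto
    then have ba: "(b, a) \<in> r" "a \<noteq> b" using less.prems by (auto simp: sym_def irrefl_def)
    let ?q = "r - {(a, b), (b, a)}"
    have c2: "card {(a, b), (b, a)} = 2" using ba by (simp add: card_insert_if)
    have eq: "card r = card ?q + 2"
      using card_Diff_subset[of "{(a, b), (b, a)}" r] ab ba c2 card_mono[of r "{(a, b), (b, a)}"]
        less.prems by auto
    moreover have "even (card ?q)"
      by (rule less.hyps) (use less.prems eq in \<open>auto simp: sym_def irrefl_def\<close>)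
    ultimately show ?thesis by simp
  qed simp
qed

text \<open>A two-factor has no bridge: otherwise the component of \<open>a\<close> would have exactly one vertex of
  odd degree.\<close>

lemma two_factor_no_bridge:
  assumes r: "two_factor E A r" and ps: "set ps \<subseteq> r" "distinct (ends ps)" "(a, a') \<in> set ps"
    and sep: "\<And>z. z \<in> set (ends ps) \<Longrightarrow> z \<noteq> a \<Longrightarrow> z \<noteq> a' \<Longrightarrow> (a, z) \<notin> r\<^sup>*"
  shows "(a, a') \<in> (r - sym_pairs ps)\<^sup>*"
proof (rule ccontr)
  assume no: "(a, a') \<notin> (r - sym_pairs ps)\<^sup>*"
  note D = two_factorD[OF r]
  define q where "q = r - sym_pairs ps"
  define K where "K = q\<^sup>* `` {a}"
  have aA: "a \<in> A" using ps D(3) by blast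
  have qA: "q \<subseteq> A \<times> A" using D(3) by (auto simp: q_def)
  have KA: "K \<subseteq> A"
  proof
    fix z assume "z \<in> K"
    then have "(a, z) \<in> q\<^sup>*" by (simp add: K_def)
    then show "z \<in> A" using aA qA by (induction rule: rtrancl_induct) auto
  qed
  have finK: "finite K" using KA D(1) finite_subset by blast
  have symq: "sym q" using D(4) sym_sym_pairs[of ps] by (auto simp: q_def sym_def)
  have closed: "z \<in> K" if "y \<in> K" "(y, z) \<in> q" for y z
    using that by (auto simp: K_def)
  have Kr: "(a, z) \<in> r\<^sup>*" if "z \<in> K" for z
    using that rtrancl_mono[of q r] by (auto simp: K_def q_def)
  have a_end: "a \<in> set (ends ps)" "a' \<in> set (ends ps)" using ps(3) by (force simp: ends_def)+
  \<comment> \<open>Of the removed ends \<open>K\<close> contains \<open>a\<close> only: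
    \<open>a'\<close> is excluded by the negated claim, the others by \<open>sep\<close>, since
    \<open>K\<close> lies in the component of \<open>a\<close> in \<open>r\<close>.\<close>
  have Kend: "z \<in> set (ends ps) \<longleftrightarrow> z = a" if "z \<in> K" for z
    using that a_end no Kr[OF that] sep[of z] by (auto simp: K_def q_def)
  have ps': "sym_pairs ps \<subseteq> r" using ps D(4) by (simp add: sym_pairs_subset_iff)
  have deg: "card (q `` {z}) = (if z = a then 1 else 2)" if "z \<in> K" for z
  proof -
    have "q `` {z} = r `` {z} - sym_pairs ps `` {z}" by (auto simp: q_def)
    moreover have "card (r `` {z} - sym_pairs ps `` {z}) = card (r `` {z}) - card (sym_pairs ps `` {z})"
      using ps' D(8) by (intro card_Diff_subset) (auto intro: finite_subset)
    ultimately show ?thesis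
      using card_sym_pairs_Image[OF ps(2), of z] Kend[OF that] D(7) that KA by auto
  qed
  let ?s = "q \<inter> K \<times> K"
  have "?s = Sigma K (\<lambda>z. q `` {z})" using closed by auto
  then have "card ?s = (\<Sum>z\<in>K. card (q `` {z}))"
    using finK finite_Image[OF finite_subset[OF _ D(6)], of q] by (simp add: q_def)
  also have "\<dots> = (\<Sum>z\<in>K. if z = a then 1 else 2)" using deg by (intro sum.cong) auto
  also have "\<dots> = 1 + (\<Sum>z\<in>K - {a}. 2)"
    using finK by (subst sum.remove[of _ a]) (auto simp: K_def)
  finally have "odd (card ?s)" by simp
  moreover have "even (card ?s)"
  proof (rule even_card_sym_irrefl)
    show "finite ?s" using finK by simp
    show "sym ?s" using symq by (auto simp: sym_def)
    show "irrefl ?s" using D(5) by (auto simp: irrefl_def q_def)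
  qed
  ultimately show False by simp
qed

text \<open>The two edges lie in different cycles, and a cycle minus one edge is still connected. So
  the old components survive the removal, and the added edges join the two of them.\<close>

lemma switch_merge:
  assumes r: "two_factor E A r" and ab: "(a, a') \<in> r" "(b, b') \<in> r" "(a, b) \<notin> r\<^sup>*"
  shows "r\<^sup>* \<subseteq> (switch r [(a, a'), (b, b')] [(a, b), (a', b')])\<^sup>*"
proof -
  note D = two_factorD[OF r]
  let ?ps = "[(a, a'), (b, b')]"
  have symr: "sym (r\<^sup>*)" using D(4) by (rule sym_rtrancl)
  have sy: "(y, x) \<in> r\<^sup>*" if "(x, y) \<in> r\<^sup>*" for x y using that symr by (auto simp: sym_def)
  have ne: "(a', b) \<notin> r\<^sup>*" "(a, b') \<notin> r\<^sup>*" "(a', b') \<notin> r\<^sup>*"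
    using ab sy by (meson rtrancl_trans r_into_rtrancl)+
  have ne': "(b, a) \<notin> r\<^sup>*" "(b, a') \<notin> r\<^sup>*" using ab ne sy by blast+
  have "a \<noteq> a'" "b \<noteq> b'" using ab D(5) by (auto simp: irrefl_def)
  then have dist: "distinct (ends ?ps)" using ab ne by (auto simp: ends_def)
  let ?q = "r - sym_pairs ?ps"
  have symq: "sym (?q\<^sup>*)"
    using D(4) sym_sym_pairs[of ?ps] by (intro sym_rtrancl) (auto simp: sym_def)
  have 1: "(a, a') \<in> ?q\<^sup>*"
    by (rule two_factor_no_bridge[OF r _ dist]) (use ab ne in \<open>auto simp: ends_def\<close>)
  have 2: "(b, b') \<in> ?q\<^sup>*"
    by (rule two_factor_no_bridge[OF r _ dist]) (use ab ne' in \<open>auto simp: ends_def\<close>)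
  have "r \<subseteq> ?q\<^sup>*"
    using 1 2 symq by (auto simp: sym_pairs_def sym_def)
  then have "r\<^sup>* \<subseteq> ?q\<^sup>*" by (rule rtrancl_subset_rtrancl)
  also have "\<dots> \<subseteq> (switch r [(a, a'), (b, b')] [(a, b), (a', b')])\<^sup>*"
    by (rule rtrancl_mono) (auto simp: switch_def)
  finally show ?thesis .
qed

section \<open>Hamiltonian cycles from connected two-factors\<close>

text \<open>Take a longest path. By maximality both neighbors of its last vertex lie on it, and one
  of them is not the predecessor; degree two forces that one to be the first vertex. The closed path
  leaves no degree for further edges, so it is a whole component.\<close>

lemma connected_two_factor_cycle:
  assumes r: "two_factor E A r" and x0: "x0 \<in> A" and conn: "\<And>z. z \<in> A \<Longrightarrow> (z, x0) \<in> r\<^sup>*"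
  obtains xs where "distinct xs" "set xs = A" "3 \<le> length xs"
    "\<And>i. i < length xs \<Longrightarrow> (xs ! i, xs ! (Suc i mod length xs)) \<in> r"
proof -
  note D = two_factorD[OF r]
  define P where "P xs \<longleftrightarrow> xs \<noteq> [] \<and> distinct xs \<and> set xs \<subseteq> A \<and> successively (\<lambda>y z. (y, z) \<in> r) xs" for xs
  have "P [x0]" using x0 by (simp add: P_def)
  moreover have "length xs < Suc (card A)" if "P xs" for xs
    using that D(1) by (metis P_def card_mono distinct_card less_Suc_eq_le)
  ultimately obtain xs where Pxs: "P xs" and max: "\<And>ys. P ys \<Longrightarrow> length ys \<le> length xs"
    using ex_has_greatest_nat[of P "[x0]" length "Suc (card A)"] by blast
  define n where "n = length xs"
  have xs: "xs \<noteq> []" "distinct xs" "set xs \<subseteq> A" using Pxs by (auto simp: P_def)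
  have step: "(xs ! i, xs ! Suc i) \<in> r" if "Suc i < n" for i
    using Pxs that by (auto simp: P_def n_def successively_conv_nth)
  have step': "(xs ! Suc i, xs ! i) \<in> r" if "Suc i < n" for i
    using step[OF that] D(4) by (auto simp: sym_def)
  have npos: "n > 0" using xs by (simp add: n_def)
  let ?y = "xs ! (n - 1)"
  have yl: "?y = last xs" using xs by (simp add: n_def last_conv_nth)
  have yA: "?y \<in> A" using xs npos by (auto simp: n_def)
  have three: False if "z \<in> A" "(z, u) \<in> r" "(z, v) \<in> r" "(z, w) \<in> r" "u \<noteq> v" "v \<noteq> w" "u \<noteq> w" for z u v w
  proof -
    have "card {u, v, w} \<le> card (r `` {z})" using that D(8) by (intro card_mono) auto
    then show False using that D(7)[OF that(1)] by simp
  qed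
  have inxs: "z \<in> set xs" if "(?y, z) \<in> r" for z
  proof (rule ccontr)
    assume "z \<notin> set xs"
    then have "P (xs @ [z])"
      using Pxs that D(3) unfolding yl by (auto simp: P_def successively_append_iff)
    then show False using max by fastforce
  qed
  have D7: "card (r `` {?y}) = 2" using D(7)[OF yA] .
  then obtain a b where abe: "r `` {?y} = {a, b}" "a \<noteq> b" by (auto simp: card_2_iff)
  then have ab: "(?y, a) \<in> r" "(?y, b) \<in> r" by auto
  obtain i j where ij: "i < n" "j < n" "xs ! i = a" "xs ! j = b"
    using inxs[OF ab(1)] inxs[OF ab(2)] by (metis in_set_conv_nth n_def)
  have "i \<noteq> n - 1" "j \<noteq> n - 1" using ij ab D(5) by (auto simp: irrefl_def)
  moreover have "i \<noteq> j" using abe ij by auto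
  \<comment> \<open>The smaller of the two indices: both are distinct and below
    \<open>n - 1\<close>.\<close>
  ultimately obtain k where k: "k + 2 < n" "(?y, xs ! k) \<in> r"
  proof (cases "i < j")
    case True
    then show ?thesis using that[of i] \<open>j \<noteq> n - 1\<close> ij ab by auto
  next
    case False
    then show ?thesis using that[of j] \<open>i \<noteq> n - 1\<close> \<open>i \<noteq> j\<close> ij ab by auto
  qed
  have "k = 0"
  proof (rule ccontr)
    assume "k \<noteq> 0"
    then obtain m where m: "k = Suc m" by (cases k) auto
    have "(xs ! k, ?y) \<in> r" using k D(4) by (auto simp: sym_def)
    moreover have "(xs ! k, xs ! m) \<in> r" "(xs ! k, xs ! Suc k) \<in> r"
      using step'[of m] step[of k] k m by auto
    moreover have "xs ! m \<noteq> ?y" "xs ! Suc k \<noteq> ?y" "xs ! m \<noteq> xs ! Suc k"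
      using k m xs(2) by (auto simp: nth_eq_iff_index_eq n_def)
    moreover have "xs ! k \<in> A" using k xs(3) by (auto simp: n_def)
    ultimately show False using three[of "xs ! k" ?y "xs ! m" "xs ! Suc k"] by metis
  qed
  then have n3: "3 \<le> n" and close: "(?y, xs ! 0) \<in> r" using k by auto
  have nxt: "(xs ! i, xs ! (Suc i mod n)) \<in> r" if "i < n" for i
  proof (cases "Suc i < n")
    case True
    then show ?thesis using step by simp
  next
    case False
    then have "i = n - 1" using that by simp
    then show ?thesis using close npos by simp
  qed
  have closed: "z \<in> set xs" if y: "y \<in> set xs" and yz: "(y, z) \<in> r" for y z
  proof (rule ccontr)
    assume nz: "z \<notin> set xs"
    obtain i where i: "i < n" "y = xs ! i" using y by (metis in_set_conv_nth n_def)
    \<comment> \<open>The cyclic predecessor of \<open>i\<close>, which differs from the cyclic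
      successor because \<open>n\<close> is at least 3.\<close>
    let ?p = "if i = 0 then n - 1 else i - 1"
    have p: "?p < n" "Suc ?p mod n = i" using i npos by auto
    have "(xs ! i, xs ! ?p) \<in> r" using nxt[OF p(1)] p(2) D(4) by (auto simp: sym_def)
    moreover have "(xs ! i, xs ! (Suc i mod n)) \<in> r" using nxt[OF i(1)] .
    moreover have "Suc i mod n \<noteq> ?p" using i n3 by (auto simp: mod_Suc)
    then have "xs ! ?p \<noteq> xs ! (Suc i mod n)"
      using p npos xs(2) nth_eq_iff_index_eq[OF xs(2), of ?p "Suc i mod n"] by (auto simp: n_def)
    moreover have "z \<noteq> xs ! ?p" "z \<noteq> xs ! (Suc i mod n)" using nz p npos by (auto simp: n_def)
    moreover have "xs ! i \<in> A" using i xs(3) by (auto simp: n_def)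
    ultimately show False using three[of y z "xs ! ?p" "xs ! (Suc i mod n)"] i yz by metis
  qed
  have "A \<subseteq> set xs"
  proof
    have *: "z \<in> set xs" if "(y, z) \<in> r\<^sup>*" "y \<in> set xs" for y z
      using that by (induction rule: rtrancl_induct) (auto intro: closed)
    have symr: "sym (r\<^sup>*)" using D(4) by (rule sym_rtrancl)
    have "x0 \<in> set xs" using *[of ?y x0] conn[OF yA] npos by (auto simp: n_def)
    fix z assume "z \<in> A"
    then have "(x0, z) \<in> r\<^sup>*" using conn symr by (auto simp: sym_def)
    then show "z \<in> set xs" using * \<open>x0 \<in> set xs\<close> by blast
  qed
  then have "set xs = A" using xs by blast
  then show thesis using that[of xs] xs n3 nxt by (simp add: n_def)
qed

lemma hamiltonian_with_projI:
  assumes r: "two_factor (parcs G) (pverts G) r" and x0: "x0 \<in> pverts G"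
    and conn: "\<And>z. z \<in> pverts G \<Longrightarrow> (z, x0) \<in> r\<^sup>*"
  shows "hamiltonian (with_proj G)"
proof -
  obtain xs where xs: "distinct xs" "set xs = pverts G" "3 \<le> length xs"
    "\<And>i. i < length xs \<Longrightarrow> (xs ! i, xs ! (Suc i mod length xs)) \<in> r"
    using connected_two_factor_cycle[OF r x0 conn] by blast
  let ?c = "zip xs (rotate1 xs)"
  \<comment> \<open>Stated for an arbitrary last vertex so that induction applies;
    \<open>z = y\<close> closes the walk later, as \<open>rotate1 xs = ys @ [y]\<close>.\<close>
  have cas: "pre_digraph.cas (with_proj G) (hd (ys @ [z])) (zip ys (tl (ys @ [z]))) z" for ys z
  proof (induction ys)
    case Nil
    then show ?case by (simp add: cas_with_proj_eq)
  next
    case (Cons y ys)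
    then show ?case by (cases ys) (auto simp: cas_with_proj_eq)
  qed
  obtain y ys where yys: "xs = y # ys" using xs(3) by (cases xs) auto
  have "pre_digraph.cas (with_proj G) y ?c y"
    using cas[of xs y] by (simp add: yys)
  moreover have "set ?c \<subseteq> parcs G"
    using xs(4) two_factorD(2)[OF r] by (auto simp: set_zip nth_rotate1)
  moreover have "y \<in> pverts G" using xs(2) yys by auto
  ultimately have aw: "pre_digraph.awalk (with_proj G) y ?c y"
    by (simp add: pre_digraph.awalk_def)
  moreover have "pre_digraph.awalk_verts (with_proj G) y ?c = y # rotate1 xs"
    using pre_digraph.awalk_verts_conv'[of "with_proj G" y ?c y] aw
    by (cases ys) (auto simp: pre_digraph.awalk_def yys)
  ultimately have "pre_digraph.cycle (with_proj G) ?c"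
    using xs(1,3) by (auto simp: pre_digraph.cycle_def yys intro!: exI[of _ y])
  moreover have "fst ` set ?c = pverts G"
    using xs(2) by (metis length_rotate1 map_fst_zip set_map)
  ultimately show ?thesis
    using xs(3) by (auto simp: hamiltonian_def intro!: exI[of _ ?c])
qed

section \<open>Residues and offsets\<close>

lemma mod_eq_shift_iff:
  fixes a :: int
  assumes "\<bar>i - j\<bar> < p"
  shows "(a + i) mod p = (a + j) mod p \<longleftrightarrow> i = j"
proof
  assume "(a + i) mod p = (a + j) mod p"
  then have "p dvd (i - j)" by (simp add: mod_eq_dvd_iff)
  then show "i = j" using assms zdvd_imp_le[of p "\<bar>i - j\<bar>"] by fastforce
qed simp

lemma mod_eq_add_cancel: "(a + k) mod p = (b + k) mod p \<longleftrightarrow> a mod p = b mod p" for a :: int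
  by (simp add: mod_eq_dvd_iff)

text \<open>\<open>D\<close> holds integer representatives, compared modulo \<open>p\<close>. It
  collects the offsets that are already used or reserved.\<close>

definition clear :: "nat \<Rightarrow> int set \<Rightarrow> int \<Rightarrow> bool" where
  "clear p D e \<longleftrightarrow> (\<forall>\<delta> \<in> D. e mod int p \<noteq> \<delta> mod int p)"

text \<open>Cyclic distance greater than \<open>R\<close>. Since \<open>f \<noteq> f'\<close>
  compares integers, distinct members are in particular incongruent modulo \<open>p\<close> if
  \<open>R \<ge> 0\<close>.\<close>

definition spread :: "nat \<Rightarrow> int \<Rightarrow> int set \<Rightarrow> bool" where
  "spread p R F \<longleftrightarrow> (\<forall>f \<in> F. \<forall>f' \<in> F. f \<noteq> f' \<longrightarrow> (\<forall>k. \<bar>k\<bar> \<le> R \<longrightarrow> (f + k) mod int p \<noteq> f' mod int p))"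

lemma spread_subset: "spread p R F \<Longrightarrow> F' \<subseteq> F \<Longrightarrow> spread p R F'"
  unfolding spread_def by blast

lemma spread_translate: "spread p R F \<Longrightarrow> spread p R ((\<lambda>f. f + t) ` F)"
  unfolding spread_def
proof (intro ballI impI allI; elim imageE)
  fix g g' k f f'
  assume *: "\<forall>f\<in>F. \<forall>f'\<in>F. f \<noteq> f' \<longrightarrow> (\<forall>k. \<bar>k\<bar> \<le> R \<longrightarrow> (f + k) mod int p \<noteq> f' mod int p)"
    "g \<noteq> g'" "\<bar>k\<bar> \<le> R" "g = f + t" "f \<in> F" "g' = f' + t" "f' \<in> F"
  then have "(f + k) mod int p \<noteq> f' mod int p" by auto
  moreover have "g + k = (f + k) + t" "g' = f' + t" using * by auto
  ultimately show "(g + k) mod int p \<noteq> g' mod int p" by (metis mod_eq_add_cancel)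
qed

text \<open>Each pair from \<open>X\<close> and \<open>D\<close> excludes one residue for
  \<open>t\<close>, and \<open>p\<close> residues are available.\<close>

lemma clear_translate_exists:
  assumes "finite X" "finite D" "card X * card D < p"
  obtains t where "\<And>x. x \<in> X \<Longrightarrow> clear p D (x + t)"
proof -
  let ?bad = "(\<lambda>(x, \<delta>). (\<delta> - x) mod int p) ` (X \<times> D)"
  have "card ?bad \<le> card X * card D"
    using card_image_le[of "X \<times> D"] assms by (metis card_cartesian_product finite_cartesian_product)
  then have "card ?bad < card {0..<int p}" using assms by simp
  then have "\<not> {0..<int p} \<subseteq> ?bad"
    using card_mono[of ?bad "{0..<int p}"] assms by fastforce
  then obtain t where t: "t \<in> {0..<int p}" "t \<notin> ?bad" by blast
  have "clear p D (x + t)" if "x \<in> X" for x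
    unfolding clear_def
  proof (intro ballI notI)
    fix \<delta> assume \<delta>: "\<delta> \<in> D" "(x + t) mod int p = \<delta> mod int p"
    then have "(\<delta> - x) mod int p = t mod int p"
      using mod_eq_add_cancel[of "\<delta> - x" x "int p" t] by (simp add: add.commute)
    also have "\<dots> = t" using t by simp
    finally show False using t(2) \<delta>(1) that by force
  qed
  then show thesis by (rule that)
qed

text \<open>The edges of the fiber cycle over a vertex of voltage \<open>c\<close>, near a position where the octagon
  switch has removed the edges starting at the offsets \<open>0\<close> and \<open>d\<close>.\<close>

definition run_steps :: "int \<Rightarrow> int \<Rightarrow> int \<Rightarrow> int rel" where
  "run_steps c d L = {(i, j). \<exists>m. \<bar>m\<bar> \<le> L \<and> m \<noteq> 0 \<and> m \<noteq> d \<and> (i = m \<and> j = m + c \<or> i = m + c \<and> j = m)}"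

lemma run_steps_run:
  assumes "\<And>k :: nat. k < n \<Longrightarrow> \<bar>a + int k * c\<bar> \<le> L \<and> a + int k * c \<noteq> 0 \<and> a + int k * c \<noteq> d"
  shows "(a, a + int n * c) \<in> (run_steps c d L)\<^sup>*" "(a + int n * c, a) \<in> (run_steps c d L)\<^sup>*"
proof -
  show *: "(a, a + int n * c) \<in> (run_steps c d L)\<^sup>*"
    using assms
  proof (induction n)
    case (Suc n)
    then have "(a, a + int n * c) \<in> (run_steps c d L)\<^sup>*" by simp
    moreover have "(a + int n * c, a + int n * c + c) \<in> run_steps c d L"
      using Suc.prems[of n] by (auto simp: run_steps_def)
    moreover have "a + int (Suc n) * c = a + int n * c + c" by (simp add: algebra_simps)
    ultimately show ?case by (metis rtrancl.rtrancl_into_rtrancl)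
  qed simp
  have "sym (run_steps c d L)" by (auto simp: sym_def run_steps_def)
  then have "sym ((run_steps c d L)\<^sup>*)" by (rule sym_rtrancl)
  then show "(a + int n * c, a) \<in> (run_steps c d L)\<^sup>*" using * by (auto dest: symD)
qed

text \<open>\<open>P\<close> holds the offsets of the new witnesses relative to the switch:
  \<open>i\<close> and \<open>i + b\<close> start intact edges within radius \<open>L\<close>, and
  from each of the four octagon corners over the root fiber intact edges lead to such a
  start.\<close>

definition octagon_window :: "int \<Rightarrow> int \<Rightarrow> int \<Rightarrow> int \<Rightarrow> int set \<Rightarrow> int \<Rightarrow> bool" where
  "octagon_window c d b R P L \<longleftrightarrow> c + d \<le> L \<and>
     (\<forall>i \<in> P. \<bar>i\<bar> \<le> L \<and> \<bar>i + b\<bar> \<le> L \<and> i \<noteq> 0 \<and> i \<noteq> d \<and> i + b \<noteq> 0 \<and> i + b \<noteq> d) \<and>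
     (\<forall>i \<in> P. \<forall>j \<in> P. i \<noteq> j \<longrightarrow> R < \<bar>i - j\<bar>) \<and>
     (\<forall>j \<in> {0, c, d, c + d}. \<exists>i \<in> P. (j, i) \<in> (run_steps c d L)\<^sup>* \<or> (j, i + b) \<in> (run_steps c d L)\<^sup>*)"

text \<open>Walking away from the switched edges leads to far offsets where the fiber is intact. Only if
  \<open>c\<close> divides \<open>d\<close>, the edges between the offsets \<open>c\<close> and \<open>d\<close> form a short isolated segment; a
  witness for it is found next to the offset \<open>c\<close>, since \<open>b \<noteq> c\<close>.\<close>

lemma octagon_window_exists:
  fixes c d b R :: int
  assumes pos: "0 < c" "0 < d" "0 < b" "0 \<le> R" and ne: "c \<noteq> d" "b \<noteq> c"
  obtains P L where "octagon_window c d b R P L"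
proof -
  \<comment> \<open>\<open>M\<close> is a multiple of \<open>c\<close>, so that walks in steps of
    \<open>c\<close> end exactly \<open>M\<close> or \<open>2 * M\<close> away, and it is large
    enough to separate the ends by more than \<open>R\<close>. The radius \<open>L\<close> reaches
    the farthest partner, \<open>c + d + 2 * M + b\<close>.\<close>
  define Q where "Q = nat (R + b + c + d)"
  define M where "M = int Q * c"
  have Q: "int Q = R + b + c + d" using pos by (simp add: Q_def)
  have MQ: "R + b + c + d \<le> M"
    using pos Q mult_left_mono[of 1 c "int Q"] by (simp add: M_def)
  define L where "L = 2 * M + b + c + d"
  have kc: "0 \<le> int k * c" for k using pos by simp
  have kQ: "int k * c + c \<le> int n * c" if "k < n" for k n
    using that mult_right_mono[of "int k + 1" "int n" c] pos by (simp add: algebra_simps)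
  have M2: "int (2 * Q) * c = 2 * M" by (simp add: M_def)
  \<comment> \<open>Going down from \<open>0\<close> all edges start at negative offsets, and going
    up from \<open>c + d\<close> all start beyond \<open>d\<close>. So both walks avoid the removed
    edges.\<close>
  have r0: "(0, - 2 * M) \<in> (run_steps c d L)\<^sup>*"
  proof -
    have "(- 2 * M + int (2 * Q) * c, - 2 * M) \<in> (run_steps c d L)\<^sup>*"
    proof (rule run_steps_run)
      fix k assume "k < 2 * Q"
      then show "\<bar>- 2 * M + int k * c\<bar> \<le> L \<and> - 2 * M + int k * c \<noteq> 0 \<and> - 2 * M + int k * c \<noteq> d"
        using kc[of k] kQ[of k "2 * Q"] M2 pos MQ unfolding L_def by (intro conjI; linarith)
    qed
    then show ?thesis unfolding M2 by simp
  qed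
  have rcd: "(c + d, c + d + 2 * M) \<in> (run_steps c d L)\<^sup>*"
  proof -
    have "(c + d, c + d + int (2 * Q) * c) \<in> (run_steps c d L)\<^sup>*"
    proof (rule run_steps_run)
      fix k assume "k < 2 * Q"
      then show "\<bar>c + d + int k * c\<bar> \<le> L \<and> c + d + int k * c \<noteq> 0 \<and> c + d + int k * c \<noteq> d"
        using kc[of k] kQ[of k "2 * Q"] M2 pos MQ unfolding L_def by (intro conjI; linarith)
    qed
    then show ?thesis unfolding M2 by simp
  qed
  show thesis
  proof (cases "c dvd d")
    case False
    \<comment> \<open>As \<open>c\<close> does not divide \<open>d\<close>, the walk up from
      \<open>c\<close> misses \<open>d\<close> and the walk down from \<open>d\<close> misses
      \<open>0\<close>; each corner gets its own far end.\<close>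
    have rc: "(c, c + M) \<in> (run_steps c d L)\<^sup>*"
    proof -
      have nd: "c + int k * c \<noteq> d" for k
        using False by (metis dvd_add_times_triv_right_iff dvd_refl)
      have "(c, c + int Q * c) \<in> (run_steps c d L)\<^sup>*"
      proof (rule run_steps_run)
        fix k assume "k < Q"
        then show "\<bar>c + int k * c\<bar> \<le> L \<and> c + int k * c \<noteq> 0 \<and> c + int k * c \<noteq> d"
          using nd[of k] kc[of k] kQ[of k Q] pos MQ unfolding L_def M_def[symmetric] by (intro conjI; linarith)
      qed
      then show ?thesis by (simp add: M_def)
    qed
    have rd: "(d, d - M) \<in> (run_steps c d L)\<^sup>*"
    proof -
      have nd: "d - M + int k * c \<noteq> 0" for k
      proof
        assume "d - M + int k * c = 0"
        then have "d = (int Q - int k) * c" by (simp add: M_def algebra_simps)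
        then show False using False by simp
      qed
      have "(d - M + int Q * c, d - M) \<in> (run_steps c d L)\<^sup>*"
      proof (rule run_steps_run)
        fix k assume "k < Q"
        then show "\<bar>d - M + int k * c\<bar> \<le> L \<and> d - M + int k * c \<noteq> 0 \<and> d - M + int k * c \<noteq> d"
          using nd[of k] kc[of k] kQ[of k Q] pos MQ unfolding L_def M_def[symmetric] by (intro conjI; linarith)
      qed
      then show ?thesis by (simp add: M_def)
    qed
    have "octagon_window c d b R {- 2 * M, c + d + 2 * M, c + M, d - M} L"
      unfolding octagon_window_def using r0 rcd rc rd MQ pos by (auto simp: L_def)
    then show ?thesis by (rule that)
  next
    case True
    then obtain m where m: "d = c * m" by auto
    then have m2: "2 \<le> m" using pos ne
      by (smt (verit) mult_cancel_left1 zero_less_mult_pos)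
    have rd: "(d, c) \<in> (run_steps c d L)\<^sup>*"
    proof -
      have eq: "c + int (nat (m - 1)) * c = d" using m m2 by (simp add: algebra_simps)
      have "(c + int (nat (m - 1)) * c, c) \<in> (run_steps c d L)\<^sup>*"
      proof (rule run_steps_run)
        fix k assume "k < nat (m - 1)"
        then show "\<bar>c + int k * c\<bar> \<le> L \<and> c + int k * c \<noteq> 0 \<and> c + int k * c \<noteq> d"
          using eq kc[of k] kQ[of k "nat (m - 1)"] pos MQ unfolding L_def by (intro conjI; linarith)
      qed
      then show ?thesis by (simp only: eq)
    qed
    \<comment> \<open>The offset \<open>c\<close> serves as the lower member of a witness pair
      unless its partner \<open>c + b\<close> is the removed start \<open>d\<close>; then it serves
      as the upper member.\<close>
    define h where "h = (if c + b \<noteq> d then c else c - b)"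
    have hc: "c = h \<or> c = h + b" by (simp add: h_def)
    have h: "h \<noteq> 0" "h \<noteq> d" "h + b \<noteq> 0" "h + b \<noteq> d" "h \<le> c" "c - b \<le> h"
      using ne pos by (auto simp: h_def split: if_splits)
    have "octagon_window c d b R {- 2 * M, c + d + 2 * M, h} L"
    proof -
      have "(j, h) \<in> (run_steps c d L)\<^sup>* \<or> (j, h + b) \<in> (run_steps c d L)\<^sup>*"
        if "j = c \<or> j = d" for j
        using that rd hc by auto
      then show ?thesis
        unfolding octagon_window_def
        using r0 rcd MQ pos h by (auto simp: L_def)
    qed
    then show ?thesis by (rule that)
  qed
qed

section \<open>Fibers and witnesses\<close>

definition nd :: "nat \<Rightarrow> 'v \<Rightarrow> int \<Rightarrow> 'v \<times> int" where
  "nd p w a = (w, a mod int p)"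

abbreviation layer :: "nat \<Rightarrow> 'v set \<Rightarrow> ('v \<times> int) set" where
  "layer p S \<equiv> S \<times> {0..<int p}"

lemma nd_eq_iff: "nd p w a = nd p x b \<longleftrightarrow> w = x \<and> a mod int p = b mod int p"
  by (auto simp: nd_def)

lemma nd_in_layer: "0 < p \<Longrightarrow> nd p w a \<in> layer p S \<longleftrightarrow> w \<in> S"
  by (auto simp: nd_def)

lemma layer_nd: "z \<in> layer p S \<Longrightarrow> z = nd p (fst z) (snd z) \<and> fst z \<in> S"
  by (auto simp: nd_def)

definition targets :: "nat \<Rightarrow> 'v \<Rightarrow> int \<Rightarrow> int set \<Rightarrow> ('v \<times> int) set" where
  "targets p w b F = nd p w ` (F \<union> (\<lambda>f. f + b) ` F)"

text \<open>In the fiber over \<open>w\<close>, whose voltage is \<open>c\<close>, the two-factor \<open>r\<close> contains all edges starting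
  outside of \<open>D\<close> and, for \<open>f \<in> F\<close>, the edges starting at \<open>f\<close> and \<open>f + b\<close>; the latter are put into
  \<open>D\<close> so that later switches leave them alone.\<close>

definition witnessed :: "nat \<Rightarrow> 'v \<Rightarrow> int \<Rightarrow> int \<Rightarrow> ('v \<times> int) rel \<Rightarrow> int set \<Rightarrow> int set \<Rightarrow> bool" where
  "witnessed p w c b r D F \<longleftrightarrow> finite D \<and>
     (\<forall>e. clear p D e \<longrightarrow> (nd p w e, nd p w (e + c)) \<in> r) \<and>
     (\<forall>f \<in> F \<union> (\<lambda>f. f + b) ` F. f \<in> D \<and> (nd p w f, nd p w (f + c)) \<in> r)"

text \<open>\<open>C\<close> contains the starts of the fiber edges that a switch may destroy. They
  are clear of \<open>D\<close>, where the witnesses are recorded, so the witnesses survive; and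
  they enter \<open>D'\<close>, so the edges outside of it are untouched.\<close>

lemma witnessed_mono:
  assumes wit: "witnessed p w c b r D F"
    and D': "D' = D \<union> B" "finite B"
    and keep: "\<And>e. (nd p w e, nd p w (e + c)) \<in> r \<Longrightarrow> clear p C e \<Longrightarrow> (nd p w e, nd p w (e + c)) \<in> r'"
    and C: "C \<subseteq> B" "\<And>e. e \<in> C \<Longrightarrow> clear p D e"
  shows "witnessed p w c b r' D' F"
  unfolding witnessed_def
proof (intro conjI allI impI ballI)
  show "finite D'" using wit D' by (simp add: witnessed_def)
next
  fix e assume "clear p D' e"
  then show "(nd p w e, nd p w (e + c)) \<in> r'"
    using wit D' C(1) by (intro keep) (auto simp: witnessed_def clear_def)
next
  fix f assume "f \<in> F \<union> (\<lambda>f. f + b) ` F"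
  then have f: "f \<in> D" "(nd p w f, nd p w (f + c)) \<in> r" using wit by (auto simp: witnessed_def)
  then show "f \<in> D'" by (simp add: D')
  have "clear p C f" unfolding clear_def using f(1) C(2) by (metis clear_def)
  then show "(nd p w f, nd p w (f + c)) \<in> r'" using f(2) keep by blast
qed

section \<open>The octagon switch\<close>

text \<open>The offset \<open>g\<close> counts in the fiber over \<open>w\<close>; its partner over
  \<open>x\<close> is \<open>g + s\<close>. In use \<open>K = L + R\<close>: radius \<open>L\<close>
  supplies intact fiber edges over \<open>w\<close>, and the extra \<open>R\<close> keeps new
  witnesses away from old ones.\<close>

definition octagon_ready ::
  "nat \<Rightarrow> 'v \<Rightarrow> 'v \<Rightarrow> int \<Rightarrow> int \<Rightarrow> int \<Rightarrow> int \<Rightarrow> ('v \<times> int) rel \<Rightarrow> int set \<Rightarrow> int \<Rightarrow> bool" where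
  "octagon_ready p w x c d s K r D g \<longleftrightarrow>
     (nd p x (g + s), nd p x (g + d + s)) \<in> r \<and>
     (nd p x (g + c + s), nd p x (g + (c + d) + s)) \<in> r \<and>
     (\<forall>i \<in> {0, c, d, c + d}. (nd p w (g + i), nd p x (g + i + s)) \<notin> r) \<and>
     (\<forall>k. \<bar>k\<bar> \<le> K \<longrightarrow> clear p D (g + k))"

definition octagon_targets :: "nat \<Rightarrow> 'v \<Rightarrow> int \<Rightarrow> int \<Rightarrow> int set \<Rightarrow> ('v \<times> int) set" where
  "octagon_targets p x c s G = (\<Union>g \<in> G. {nd p x (g + s), nd p x (g + c + s)})"

text \<open>Every component changed by the switch contains a corner. A corner over \<open>x\<close>
  is linked by its new edge to one over \<open>w\<close>, from which intact edges lead to a new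
  witness. So the targets over \<open>x\<close> at \<open>g\<close> are traded for witnesses over
  \<open>w\<close>, at the price of a window of \<open>2 * L + 1\<close> offsets in
  \<open>D'\<close>.\<close>

lemma octagon_step:
  fixes E :: "('v \<times> int) rel"
  assumes tf: "two_factor E A r" and symE: "sym E"
    and rung: "\<And>a. (nd p w a, nd p x (a + s)) \<in> E" and wx: "w \<noteq> x"
    and pos: "0 < c" "0 < d" "c \<noteq> d" "0 \<le> R"
    and win: "octagon_window c d b R P L" and p: "2 * L + R < int p"
    and wit: "witnessed p w c b r D F" and spr: "spread p R F"
    and G: "spread p (2 * L + R) (insert g G)" "g \<notin> G"
    and ready: "\<And>h. h \<in> insert g G \<Longrightarrow> octagon_ready p w x c d s (L + R) r D h"
    and span: "spans r A (targets p w b F \<union> octagon_targets p x c s (insert g G))"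
  obtains r' D' F' where "two_factor E A r'" "witnessed p w c b r' D' F'" "spread p R F'"
    "\<And>h. h \<in> G \<Longrightarrow> octagon_ready p w x c d s (L + R) r' D' h"
    "spans r' A (targets p w b F' \<union> octagon_targets p x c s G)"
    "card D' \<le> card D + nat (2 * L + 1)"
proof -
  define W where "W i = nd p w (g + i)" for i
  define X where "X i = nd p x (g + i + s)" for i
  let ?I = "{0, c, d, c + d}"
  define ps where "ps = [(W 0, W c), (W d, W (c + d)), (X 0, X d), (X c, X (c + d))]"
  define qs where "qs = [(W 0, X 0), (W c, X c), (W d, X d), (W (c + d), X (c + d))]"
  define r' where "r' = switch r ps qs"
  define D' where "D' = D \<union> {g - L..g + L}"
  define F' where "F' = F \<union> (\<lambda>i. g + i) ` P"
  have cdL: "c + d \<le> L" using win by (simp add: octagon_window_def)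
  have WW: "W i = W j \<longleftrightarrow> i = j" if "\<bar>i - j\<bar> < int p" for i j
    using that mod_eq_shift_iff[of i j "int p" g] by (simp add: W_def nd_eq_iff)
  have XX: "X i = X j \<longleftrightarrow> i = j" if "\<bar>i - j\<bar> < int p" for i j
    using that mod_eq_shift_iff[of i j "int p" "g + s"]
    by (simp add: X_def nd_eq_iff algebra_simps)
  have WX: "W i \<noteq> X j" "X j \<noteq> W i" for i j using wx by (auto simp: W_def X_def nd_eq_iff)
  have rg: "octagon_ready p w x c d s (L + R) r D g" using ready by simp
  have clr: "clear p D (g + k)" if "\<bar>k\<bar> \<le> L + R" for k
    using rg that by (auto simp: octagon_ready_def)
  have We: "(W i, W (i + c)) \<in> r" if "\<bar>i\<bar> \<le> L" for i
    using clr[of i] that pos wit by (auto simp: witnessed_def W_def add.assoc)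
  have dist: "distinct (ends ps)" "distinct (ends qs)"
    using pos cdL p by (auto simp: ends_def ps_def qs_def WW XX WX)
  have eqe: "set (ends ps) = set (ends qs)" by (auto simp: ends_def ps_def qs_def)
  have ends_ps: "set (ends ps) = W ` ?I \<union> X ` ?I" by (auto simp: ends_def ps_def)
  have psr: "set ps \<subseteq> r"
    using We[of 0] We[of d] rg pos cdL by (auto simp: ps_def X_def octagon_ready_def add.commute)
  have qsE: "set qs \<subseteq> E" using rung by (auto simp: qs_def W_def X_def)
  have qsr: "set qs \<inter> r = {}" using rg by (auto simp: qs_def W_def X_def octagon_ready_def)
  have tf': "two_factor E A r'"
    unfolding r'_def by (rule two_factor_switch[OF tf symE psr dist(1) qsE dist(2) qsr eqe])
  have kept: "(y, z) \<in> r'" if "(y, z) \<in> r" "(y, z) \<notin> sym_pairs ps" for y z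
    using that by (simp add: r'_def switch_def)
  \<comment> \<open>Used to exclude that the edge from \<open>e\<close> to \<open>e + c\<close> is a
    removed edge read backwards: this would need \<open>2 * c\<close> to vanish modulo
    \<open>p\<close>.\<close>
  have c2: "(a + c + c) mod int p \<noteq> a mod int p" for a
    using mod_eq_shift_iff[of "c + c" 0 "int p" a] pos cdL p by (simp add: add.assoc)
  have keepw: "(nd p w e, nd p w (e + c)) \<in> r'"
    if e: "(nd p w e, nd p w (e + c)) \<in> r" and ce: "clear p {g, g + d} e" for e
  proof (rule kept[OF e])
    have neq: "nd p w e \<noteq> W 0" "nd p w e \<noteq> W d"
      using ce by (auto simp: W_def nd_eq_iff clear_def)
    have "(nd p w e, nd p w (e + c)) \<noteq> (W c, W 0)"
      using c2[of g] mod_eq_add_cancel[of e c "int p" "g + c"] by (auto simp: W_def nd_eq_iff)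
    moreover have "(nd p w e, nd p w (e + c)) \<noteq> (W (c + d), W d)"
      using c2[of "g + d"] mod_eq_add_cancel[of e c "int p" "g + d + c"]
      by (auto simp: W_def nd_eq_iff algebra_simps)
    ultimately show "(nd p w e, nd p w (e + c)) \<notin> sym_pairs ps"
      using neq wx by (auto simp: sym_pairs_def ps_def X_def nd_eq_iff)
  qed
  have wit0: "witnessed p w c b r' D' F"
  proof (rule witnessed_mono[OF wit D'_def _ keepw])
    show "{g, g + d} \<subseteq> {g - L..g + L}" using pos cdL by auto
    show "clear p D e" if "e \<in> {g, g + d}" for e
      using that clr[of 0] clr[of d] pos cdL by auto
  qed auto
  have Pin: "\<bar>i\<bar> \<le> L" "\<bar>i + b\<bar> \<le> L" "i \<noteq> 0" "i \<noteq> d" "i + b \<noteq> 0" "i + b \<noteq> d" if "i \<in> P" for i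
    using win that by (auto simp: octagon_window_def)
  have run: "(W m, W (m + c)) \<in> r'" if "\<bar>m\<bar> \<le> L" "m \<noteq> 0" "m \<noteq> d" for m
  proof -
    have "clear p {g, g + d} (g + m)"
      using that pos cdL p mod_eq_shift_iff[of m 0 "int p" g] mod_eq_shift_iff[of m d "int p" g]
      by (auto simp: clear_def)
    then show ?thesis using keepw[of "g + m"] We[of m] that by (simp add: W_def add.assoc)
  qed
  have wit': "witnessed p w c b r' D' F'"
    unfolding witnessed_def
  proof (intro conjI allI impI ballI)
    show "finite D'" using wit0 by (simp add: witnessed_def)
  next
    fix e assume "clear p D' e"
    then show "(nd p w e, nd p w (e + c)) \<in> r'" using wit0 by (simp add: witnessed_def)
  next
    fix f assume "f \<in> F' \<union> (\<lambda>f. f + b) ` F'"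
    then consider "f \<in> F \<union> (\<lambda>f. f + b) ` F" | i where "i \<in> P" "f = g + i \<or> f = g + (i + b)"
      by (auto simp: F'_def add.assoc)
    then have "f \<in> D' \<and> (nd p w f, nd p w (f + c)) \<in> r'"
    proof cases
      case 1
      then show ?thesis using wit0 by (simp add: witnessed_def)
    next
      case 2
      then obtain m where m: "f = g + m" "\<bar>m\<bar> \<le> L" "m \<noteq> 0" "m \<noteq> d" using Pin by metis
      then show ?thesis using run[of m] by (auto simp: D'_def W_def add.assoc)
    qed
    then show "f \<in> D'" "(nd p w f, nd p w (f + c)) \<in> r'" by auto
  qed
  have FD: "f \<in> D" if "f \<in> F" for f using wit that by (auto simp: witnessed_def)
  have spr': "spread p R F'"
    unfolding spread_def
  proof (intro ballI impI allI)
    fix f f' k assume f: "f \<in> F'" and f': "f' \<in> F'" and ne: "f \<noteq> f'" and k: "\<bar>k\<bar> \<le> R"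
    \<comment> \<open>Old witnesses are recorded in \<open>D\<close>, which is clear of the radius
      \<open>L + R\<close> around \<open>g\<close>.\<close>
    have new_old: "(g + i + k) mod int p \<noteq> h mod int p" if "i \<in> P" "h \<in> F" "\<bar>k\<bar> \<le> R" for i h k
      using clr[of "i + k"] FD[OF that(2)] Pin(1)[OF that(1)] that(3)
      by (fastforce simp: clear_def add.assoc)
    have old_new: "(h + k) mod int p \<noteq> (g + i) mod int p" if "i \<in> P" "h \<in> F" for i h
      using new_old[OF that, of "- k"] k mod_eq_add_cancel[of h k "int p" "g + i - k"] by auto
    have new_new: "(g + i + k) mod int p \<noteq> (g + j) mod int p" if "i \<in> P" "j \<in> P" "i \<noteq> j" for i j
    proof -
      have "R < \<bar>i - j\<bar>" using win that by (auto simp: octagon_window_def)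
      then have "i + k \<noteq> j" using k by auto
      moreover have "\<bar>i + k - j\<bar> < int p" using Pin(1)[OF that(1)] Pin(1)[OF that(2)] k p by linarith
      ultimately show ?thesis using mod_eq_shift_iff[of "i + k" j "int p" g] by (simp add: add.assoc)
    qed
    show "(f + k) mod int p \<noteq> f' mod int p"
      using f f' ne spr k new_old old_new new_new by (auto simp: F'_def spread_def)
  qed
  have ready': "octagon_ready p w x c d s (L + R) r' D' h" if h: "h \<in> G" for h
  proof -
    have rh: "octagon_ready p w x c d s (L + R) r D h" using ready h by simp
    \<comment> \<open>The radius \<open>L\<close> around \<open>g\<close> and the radius
      \<open>L + R\<close> around \<open>h\<close> do not meet, since \<open>g\<close> and
      \<open>h\<close> are more than \<open>2 * L + R\<close> apart.\<close>
    have far: "(h + k) mod int p \<noteq> (g + j) mod int p" if "\<bar>k - j\<bar> \<le> 2 * L + R" for k j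
    proof -
      have "(h + (k - j)) mod int p \<noteq> g mod int p"
        using G h that by (auto simp: spread_def)
      then show ?thesis using mod_eq_add_cancel[of "h + (k - j)" j "int p" g] by simp
    qed
    have Xne: "nd p x (h + i + s) \<noteq> X j" if "i \<in> ?I" "j \<in> ?I" for i j
    proof -
      have "0 \<le> i" "i \<le> L" "0 \<le> j" "j \<le> L" using that pos cdL by auto
      then have "\<bar>i - j\<bar> \<le> 2 * L + R" using pos(4) by linarith
      then show ?thesis
        using far[of i j] mod_eq_add_cancel[of "h + i" s "int p" "g + j"] by (auto simp: X_def nd_eq_iff)
    qed
    have nops: "nd p x (h + i + s) \<notin> set (ends ps)" if "i \<in> ?I" for i
      using Xne[OF that] wx by (auto simp: ends_ps W_def nd_eq_iff)
    have "(nd p x (h + 0 + s), nd p x (h + d + s)) \<in> r'"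
      using rh nops[of 0] by (intro kept) (auto simp: octagon_ready_def dest: sym_pairs_ends)
    moreover have "(nd p x (h + c + s), nd p x (h + (c + d) + s)) \<in> r'"
      using rh nops[of c] by (intro kept) (auto simp: octagon_ready_def dest: sym_pairs_ends)
    moreover have "(nd p w (h + i), nd p x (h + i + s)) \<notin> r'" if "i \<in> ?I" for i
    proof -
      have "(nd p w (h + i), nd p x (h + i + s)) \<notin> r" using rh that by (auto simp: octagon_ready_def)
      moreover have "nd p x (h + i + s) \<notin> set (ends qs)" using nops[OF that] eqe by simp
      ultimately show ?thesis by (auto simp: r'_def switch_def dest: sym_pairs_ends)
    qed
    moreover have "clear p D' (h + k)" if "\<bar>k\<bar> \<le> L + R" for k
      unfolding clear_def
    proof
      fix \<delta> assume "\<delta> \<in> D'"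
      then consider "\<delta> \<in> D" | "\<bar>\<delta> - g\<bar> \<le> L"
        by (auto simp: D'_def abs_le_iff)
      then show "(h + k) mod int p \<noteq> \<delta> mod int p"
      proof cases
        case 1
        then show ?thesis using rh that by (auto simp: octagon_ready_def clear_def)
      next
        case 2
        then have "\<bar>k - (\<delta> - g)\<bar> \<le> 2 * L + R" using that by linarith
        then show ?thesis using far[of k "\<delta> - g"] by simp
      qed
    qed
    ultimately show ?thesis by (simp add: octagon_ready_def)
  qed
  have card': "card D' \<le> card D + nat (2 * L + 1)"
    using card_Un_le[of D "{g - L..g + L}"] by (simp add: D'_def)
  have symr': "sym r'" using tf' by (rule two_factorD)
  have Wrun: "(W i, W j) \<in> r'\<^sup>*" if "(i, j) \<in> (run_steps c d L)\<^sup>*" for i j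
    using that
  proof (induction rule: rtrancl_induct)
    case (step j k)
    then have "(W j, W k) \<in> r'" using run symr' by (auto simp: run_steps_def dest: symD)
    then show ?case using step.IH by simp
  qed simp
  have Wend: "\<exists>t \<in> targets p w b F'. (W i, t) \<in> r'\<^sup>*" if i: "i \<in> ?I" for i
  proof -
    obtain j where j: "j \<in> P" "(i, j) \<in> (run_steps c d L)\<^sup>* \<or> (i, j + b) \<in> (run_steps c d L)\<^sup>*"
      using win i unfolding octagon_window_def by blast
    have gj: "g + j \<in> F'" using j(1) by (simp add: F'_def)
    then have "W j \<in> targets p w b F'" unfolding targets_def W_def by (intro imageI UnI1)
    moreover have "W (j + b) \<in> targets p w b F'"
      unfolding targets_def W_def add.assoc[symmetric] by (intro imageI UnI2 gj)
    ultimately show ?thesis using j(2) Wrun by blast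
  qed
  have Xend: "\<exists>t \<in> targets p w b F'. (X i, t) \<in> r'\<^sup>*" if "i \<in> ?I" for i
  proof -
    have "(X i, W i) \<in> r'" using that by (auto simp: r'_def switch_def sym_pairs_def qs_def)
    then show ?thesis using Wend[OF that] by (meson converse_rtrancl_into_rtrancl)
  qed
  have "spans r' (targets p w b F \<union> octagon_targets p x c s (insert g G) \<union> set (ends ps))
    (targets p w b F' \<union> octagon_targets p x c s G)"
    unfolding spans_def
  proof
    fix z assume "z \<in> targets p w b F \<union> octagon_targets p x c s (insert g G) \<union> set (ends ps)"
    then have "z \<in> targets p w b F \<union> octagon_targets p x c s G \<or> z \<in> W ` ?I \<or> z \<in> X ` ?I"
      by (auto simp: octagon_targets_def X_def ends_ps)
    moreover have "targets p w b F \<subseteq> targets p w b F'" by (auto simp: targets_def F'_def)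
    ultimately show "\<exists>t\<in>targets p w b F' \<union> octagon_targets p x c s G. (z, t) \<in> r'\<^sup>*"
      using Wend Xend by blast
  qed
  then have "spans r' A (targets p w b F' \<union> octagon_targets p x c s G)"
    using spans_switch[OF span, of ps qs] spans_trans unfolding r'_def by blast
  then show thesis using that tf' wit' spr' ready' card' by blast
qed

text \<open>One switch per element of \<open>G\<close>, each dropping its targets over
  \<open>x\<close>, until all targets lie in the fiber over \<open>w\<close>.\<close>

lemma octagon_steps:
  fixes E :: "('v \<times> int) rel"
  assumes symE: "sym E"
    and rung: "\<And>a. (nd p w a, nd p x (a + s)) \<in> E" and wx: "w \<noteq> x"
    and pos: "0 < c" "0 < d" "c \<noteq> d" "0 \<le> R"
    and win: "octagon_window c d b R P L" and p: "2 * L + R < int p"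
    and "finite G"
  shows "\<lbrakk>two_factor E A r; witnessed p w c b r D F; spread p R F; spread p (2 * L + R) G;
    \<forall>h \<in> G. octagon_ready p w x c d s (L + R) r D h;
    spans r A (targets p w b F \<union> octagon_targets p x c s G)\<rbrakk> \<Longrightarrow>
    \<exists>r' D' F'. two_factor E A r' \<and> witnessed p w c b r' D' F' \<and> spread p R F' \<and>
      spans r' A (targets p w b F') \<and> card D' \<le> card D + card G * nat (2 * L + 1)"
  using \<open>finite G\<close>
proof (induction G arbitrary: r D F rule: finite_induct)
  case empty
  then show ?case by (intro exI[of _ r] exI[of _ D] exI[of _ F]) (simp add: octagon_targets_def)
next
  case (insert g G)
  obtain r' D' F' where *: "two_factor E A r'" "witnessed p w c b r' D' F'" "spread p R F'"
    "\<And>h. h \<in> G \<Longrightarrow> octagon_ready p w x c d s (L + R) r' D' h"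
    "spans r' A (targets p w b F' \<union> octagon_targets p x c s G)"
    "card D' \<le> card D + nat (2 * L + 1)"
    by (rule octagon_step[OF insert.prems(1) symE rung wx pos win p insert.prems(2,3,4)
          insert.hyps(2) bspec[OF insert.prems(5)] insert.prems(6)]) auto
  have "spread p (2 * L + R) G" using insert.prems(4) spread_subset by blast
  then obtain r'' D'' F'' where "two_factor E A r''" "witnessed p w c b r'' D'' F''" "spread p R F''"
    "spans r'' A (targets p w b F'')" "card D'' \<le> card D' + card G * nat (2 * L + 1)"
    using insert.IH[OF *(1-3)] *(4,5) by blast
  then show ?case
    using *(6) insert.hyps by (intro exI[of _ r''] exI[of _ D''] exI[of _ F'']) auto
qed

section \<open>The square switch\<close>

definition square_ready ::
  "nat \<Rightarrow> 'v \<Rightarrow> 'v \<Rightarrow> int \<Rightarrow> int \<Rightarrow> ('v \<times> int) rel \<Rightarrow> int set \<Rightarrow> int \<Rightarrow> bool" where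
  "square_ready p w x c s r D g \<longleftrightarrow> clear p D g \<and>
     (nd p x (g + s), nd p x (g + c + s)) \<in> r \<and>
     (nd p w g, nd p x (g + s)) \<notin> r \<and> (nd p w (g + c), nd p x (g + c + s)) \<notin> r"

text \<open>By \<open>not_conn\<close> the two removed fiber edges lie in different components, so
  \<open>switch_merge\<close> applies. Connectivity only grows, and the witnesses \<open>F\<close>
  can be kept.\<close>

lemma square_step:
  fixes E :: "('v \<times> int) rel"
  assumes tf: "two_factor E A r" and symE: "sym E"
    and rung: "\<And>a. (nd p w a, nd p x (a + s)) \<in> E" and wx: "w \<noteq> x"
    and c: "0 < c" "2 * c < int p"
    and wit: "witnessed p w c b r D F"
    and G: "spread p c (insert g G)" "g \<notin> G"
    and ready: "\<And>h. h \<in> insert g G \<Longrightarrow> square_ready p w x c s r D h"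
    and not_conn: "(nd p w g, nd p x (g + s)) \<notin> r\<^sup>*"
  obtains r' D' where "two_factor E A r'" "witnessed p w c b r' D' F"
    "\<And>h. h \<in> G \<Longrightarrow> square_ready p w x c s r' D' h"
    "r\<^sup>* \<subseteq> r'\<^sup>*" "(nd p w g, nd p x (g + s)) \<in> r'\<^sup>*" "card D' \<le> card D + 1"
proof -
  define W where "W i = nd p w (g + i)" for i
  define X where "X i = nd p x (g + i + s)" for i
  define ps where "ps = [(W 0, W c), (X 0, X c)]"
  define qs where "qs = [(W 0, X 0), (W c, X c)]"
  define r' where "r' = switch r ps qs"
  have WW: "W i = W j \<longleftrightarrow> i = j" if "\<bar>i - j\<bar> < int p" for i j
    using that mod_eq_shift_iff[of i j "int p" g] by (simp add: W_def nd_eq_iff)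
  have XX: "X i = X j \<longleftrightarrow> i = j" if "\<bar>i - j\<bar> < int p" for i j
    using that mod_eq_shift_iff[of i j "int p" "g + s"] by (simp add: X_def nd_eq_iff algebra_simps)
  have WX: "W i \<noteq> X j" "X j \<noteq> W i" for i j using wx by (auto simp: W_def X_def nd_eq_iff)
  have rg: "square_ready p w x c s r D g" using ready by simp
  have We: "(W 0, W c) \<in> r" using rg wit by (auto simp: W_def square_ready_def witnessed_def)
  have Xe: "(X 0, X c) \<in> r" using rg by (auto simp: X_def square_ready_def)
  have dist: "distinct (ends ps)" "distinct (ends qs)"
    using c by (auto simp: ends_def ps_def qs_def WW XX WX)
  have eqe: "set (ends ps) = set (ends qs)" by (auto simp: ends_def ps_def qs_def)
  have psr: "set ps \<subseteq> r" using We Xe by (simp add: ps_def)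
  have qsE: "set qs \<subseteq> E" using rung by (auto simp: qs_def W_def X_def)
  have qsr: "set qs \<inter> r = {}" using rg by (auto simp: qs_def W_def X_def square_ready_def)
  have tf': "two_factor E A r'"
    unfolding r'_def by (rule two_factor_switch[OF tf symE psr dist(1) qsE dist(2) qsr eqe])
  have kept: "(y, z) \<in> r'" if "(y, z) \<in> r" "(y, z) \<notin> sym_pairs ps" for y z
    using that by (simp add: r'_def switch_def)
  have mono: "r\<^sup>* \<subseteq> r'\<^sup>*"
    unfolding r'_def ps_def qs_def
    using not_conn We Xe by (intro switch_merge[OF tf]) (auto simp: W_def X_def)
  have "(W 0, X 0) \<in> r'" by (auto simp: r'_def switch_def sym_pairs_def qs_def)
  then have conn: "(nd p w g, nd p x (g + s)) \<in> r'\<^sup>*" by (simp add: W_def X_def r_into_rtrancl)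
  have c2: "(a + c + c) mod int p \<noteq> a mod int p" for a
    using mod_eq_shift_iff[of "c + c" 0 "int p" a] c by (simp add: add.assoc)
  have keepw: "(nd p w e, nd p w (e + c)) \<in> r'"
    if e: "(nd p w e, nd p w (e + c)) \<in> r" and ce: "clear p {g} e" for e
  proof (rule kept[OF e])
    have "nd p w e \<noteq> W 0" using ce by (auto simp: W_def nd_eq_iff clear_def)
    moreover have "(nd p w e, nd p w (e + c)) \<noteq> (W c, W 0)"
      using c2[of g] mod_eq_add_cancel[of e c "int p" "g + c"] by (auto simp: W_def nd_eq_iff)
    ultimately show "(nd p w e, nd p w (e + c)) \<notin> sym_pairs ps"
      using wx by (auto simp: sym_pairs_def ps_def X_def nd_eq_iff)
  qed
  have wit': "witnessed p w c b r' (D \<union> {g}) F"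
    by (rule witnessed_mono[OF wit refl _ keepw]) (use rg in \<open>auto simp: square_ready_def\<close>)
  have ready': "square_ready p w x c s r' (D \<union> {g}) h" if h: "h \<in> G" for h
  proof -
    have rh: "square_ready p w x c s r D h" using ready h by simp
    have far: "(h + k) mod int p \<noteq> (g + j) mod int p" if "\<bar>k - j\<bar> \<le> c" for k j
    proof -
      have "(h + (k - j)) mod int p \<noteq> g mod int p"
        using G h that by (auto simp: spread_def)
      then show ?thesis using mod_eq_add_cancel[of "h + (k - j)" j "int p" g] by simp
    qed
    have nops: "nd p x (h + i + s) \<notin> set (ends ps)" if "i = 0 \<or> i = c" for i
    proof -
      have "nd p x (h + i + s) \<noteq> X j" if "j = 0 \<or> j = c" for j
        using far[of i j] that \<open>i = 0 \<or> i = c\<close> c mod_eq_add_cancel[of "h + i" s "int p" "g + j"]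
        by (auto simp: X_def nd_eq_iff)
      then show ?thesis using wx by (auto simp: ends_def ps_def W_def nd_eq_iff)
    qed
    have "(nd p x (h + 0 + s), nd p x (h + c + s)) \<in> r'"
      using rh nops[of 0] by (intro kept) (auto simp: square_ready_def dest: sym_pairs_ends)
    moreover have "(nd p w (h + i), nd p x (h + i + s)) \<notin> r'" if "i = 0 \<or> i = c" for i
      using rh that nops[OF that] eqe
      by (auto simp: r'_def switch_def square_ready_def dest: sym_pairs_ends)
    from this[of 0] this[of c] have "(nd p w h, nd p x (h + s)) \<notin> r'"
      "(nd p w (h + c), nd p x (h + c + s)) \<notin> r'" by auto
    moreover have "clear p (D \<union> {g}) h"
      using rh far[of 0 0] c by (auto simp: square_ready_def clear_def)
    ultimately show ?thesis by (simp add: square_ready_def)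
  qed
  have "card (D \<union> {g}) \<le> card D + 1" using card_Un_le[of D "{g}"] by simp
  then show thesis using that tf' wit' ready' mono conn by blast
qed

lemma square_steps:
  fixes E :: "('v \<times> int) rel"
  assumes symE: "sym E"
    and rung: "\<And>a. (nd p w a, nd p x (a + s)) \<in> E" and wx: "w \<noteq> x"
    and c: "0 < c" "2 * c < int p"
    and "finite G" and wB: "\<And>a. nd p w a \<in> B"
  shows "\<lbrakk>two_factor E A r; witnessed p w c b r D F; spread p c G;
    \<forall>h \<in> G. square_ready p w x c s r D h; spans r B W;
    spans r A (W \<union> (\<lambda>g. nd p x (g + s)) ` G)\<rbrakk> \<Longrightarrow>
    \<exists>r' D'. two_factor E A r' \<and> witnessed p w c b r' D' F \<and>
      spans r' A W \<and> card D' \<le> card D + card G"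
  using \<open>finite G\<close>
proof (induction G arbitrary: r D rule: finite_induct)
  case empty
  then show ?case by (intro exI[of _ r] exI[of _ D]) simp
next
  case (insert g G)
  note tf = insert.prems(1) and wit = insert.prems(2) and spr = insert.prems(3)
    and ready = bspec[OF insert.prems(4)] and spB = insert.prems(5) and spA = insert.prems(6)
  obtain r' D' where *: "two_factor E A r'" "witnessed p w c b r' D' F"
    "\<And>h. h \<in> G \<Longrightarrow> square_ready p w x c s r' D' h"
    "r\<^sup>* \<subseteq> r'\<^sup>*" "(nd p w g, nd p x (g + s)) \<in> r'\<^sup>*" "card D' \<le> card D + 1"
  proof (cases "(nd p w g, nd p x (g + s)) \<in> r\<^sup>*")
    \<comment> \<open>Switching inside one component might split it. Here the target at
      \<open>g\<close> already reaches the fiber over \<open>w\<close>, so the two-factor is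
      kept.\<close>
    case True
    show ?thesis by (rule that[of r D]) (use True tf wit ready in auto)
  next
    case False
    show ?thesis
      by (rule square_step[OF tf symE rung wx c wit spr insert.hyps(2) ready False]) (auto intro: that)
  qed
  have spB': "spans r' B W" using spB *(4) by (rule spans_mono) simp
  have "sym (r'\<^sup>*)" using *(1) by (intro sym_rtrancl two_factorD)
  then have "(nd p x (g + s), nd p w g) \<in> r'\<^sup>*" using *(5) by (auto dest: symD)
  moreover obtain t where "t \<in> W" "(nd p w g, t) \<in> r'\<^sup>*"
    using spB' wB[of g] unfolding spans_def by blast
  ultimately have "\<exists>t \<in> W. (nd p x (g + s), t) \<in> r'\<^sup>*" by (meson rtrancl_trans)
  then have "spans r' (W \<union> (\<lambda>g. nd p x (g + s)) ` insert g G) (W \<union> (\<lambda>g. nd p x (g + s)) ` G)"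
    unfolding spans_def by blast
  then have spA': "spans r' A (W \<union> (\<lambda>g. nd p x (g + s)) ` G)"
    using spans_mono[OF spA *(4) order_refl] spans_trans by blast
  have "spread p c G" using spr spread_subset by blast
  then obtain r'' D'' where "two_factor E A r''" "witnessed p w c b r'' D'' F"
    "spans r'' A W" "card D'' \<le> card D' + card G"
    using insert.IH[OF *(1,2)] *(3) spB' spA' by blast
  then show ?case
    using *(6) insert.hyps by (intro exI[of _ r''] exI[of _ D'']) auto
qed

section \<open>Attaching branches\<close>

text \<open>Simultaneous translation of all fibers, an automorphism of the lift. It rotates a branch
  before the branch is attached.\<close>

definition shift :: "nat \<Rightarrow> int \<Rightarrow> 'v \<times> int \<Rightarrow> 'v \<times> int" where
  "shift p t = (\<lambda>(y, a). (y, (a + t) mod int p))"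

lemma shift_nd [simp]: "shift p t (nd p w a) = nd p w (a + t)"
  by (simp add: shift_def nd_def mod_add_left_eq)

lemma inj_on_shift: "inj_on (shift p t) (layer p S)"
proof (rule inj_onI)
  fix y z assume "y \<in> layer p S" "z \<in> layer p S" "shift p t y = shift p t z"
  then show "y = z"
    using mod_eq_add_cancel[of "snd y" t "int p" "snd z"] by (auto simp: shift_def)
qed

lemma shift_layer:
  assumes "0 < p"
  shows "shift p t ` layer p S = layer p S"
proof
  show "shift p t ` layer p S \<subseteq> layer p S" using assms by (auto simp: shift_def)
  show "layer p S \<subseteq> shift p t ` layer p S"
  proof
    fix z assume z: "z \<in> layer p S"
    show "z \<in> shift p t ` layer p S"
    proof (rule image_eqI)
      show "z = shift p t (nd p (fst z) (snd z - t))" using layer_nd[OF z] by simp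
      show "nd p (fst z) (snd z - t) \<in> layer p S" using assms z by (auto simp: nd_def)
    qed
  qed
qed

text \<open>The properties of the lift on which the construction rests, with \<open>c w\<close> the
  step of the fiber over \<open>w\<close>. All \<open>p\<close> are treated as one family because
  the bounds have to be uniform in \<open>p\<close>.\<close>

locale lift_family =
  fixes V :: "'v set" and nb :: "'v \<Rightarrow> 'v \<Rightarrow> bool" and c :: "'v \<Rightarrow> int" and E :: "nat \<Rightarrow> ('v \<times> int) rel"
  assumes c_pos: "w \<in> V \<Longrightarrow> 0 < c w"
    and sym_E: "sym (E p)"
    and fiber_E: "w \<in> V \<Longrightarrow> 0 < p \<Longrightarrow> (nd p w a, nd p w (a + c w)) \<in> E p"
    and rung_E: "nb w x \<Longrightarrow> \<exists>s. \<forall>p a. 0 < p \<longrightarrow> (nd p w a, nd p x (a + s)) \<in> E p"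
    and shift_E: "0 < p \<Longrightarrow> (y, z) \<in> E p \<Longrightarrow> (shift p t y, shift p t z) \<in> E p"
begin

text \<open>The two-factor over a subtree with vertex set \<open>S\<close> and root
  \<open>w\<close>. Gap \<open>b\<close> and distance \<open>R\<close> are dictated by the way
  \<open>w\<close> is attached to its parent; an octagon, for instance, needs two edges over
  \<open>w\<close> whose starts differ by the step of the parent.\<close>

definition state ::
  "nat \<Rightarrow> 'v set \<Rightarrow> 'v \<Rightarrow> int \<Rightarrow> int \<Rightarrow> ('v \<times> int) rel \<Rightarrow> int set \<Rightarrow> int set \<Rightarrow> bool" where
  "state p S w b R r D F \<longleftrightarrow> two_factor (E p) (layer p S) r \<and> witnessed p w (c w) b r D F \<and>
     spread p R F \<and> spans r (layer p S) (targets p w b F)"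

text \<open>The quantifier order lets the parent prescribe \<open>b\<close> and \<open>R\<close>.
  The bound \<open>B\<close> on used offsets does not depend on \<open>p\<close>, so large
  \<open>p\<close> leave room for rotations. The condition \<open>b \<noteq> c w\<close> comes from
  \<open>octagon_window_exists\<close>.\<close>

definition branch :: "'v set \<Rightarrow> 'v \<Rightarrow> bool" where
  "branch S w \<longleftrightarrow> (\<forall>b R. 0 < b \<longrightarrow> b \<noteq> c w \<longrightarrow> 0 \<le> R \<longrightarrow>
     (\<exists>N B. \<forall>p \<ge> N. prime p \<longrightarrow> (\<exists>r D F. state p S w b R r D F \<and> card D \<le> B)))"

definition connected_root :: "'v set \<Rightarrow> 'v \<Rightarrow> bool" where
  "connected_root S w \<longleftrightarrow> (\<exists>N B. \<forall>p \<ge> N. prime p \<longrightarrow>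
     (\<exists>r D. two_factor (E p) (layer p S) r \<and> witnessed p w (c w) 1 r D {} \<and>
       spans r (layer p S) {nd p w 0} \<and> card D \<le> B))"

lemma witnessed_finite: "witnessed p w k b r D F \<Longrightarrow> finite D \<and> F \<subseteq> D \<and> finite F \<and> card F \<le> card D"
  by (auto simp: witnessed_def intro: finite_subset card_mono)

lemma shifted_Un:
  assumes r: "two_factor (E p) (layer p S) r" and r': "two_factor (E p) (layer p S') r'"
    and disj: "S \<inter> S' = {}" and p: "0 < p"
    and r0_def: "r0 = r \<union> map_prod (shift p t) (shift p t) ` r'"
  shows "two_factor (E p) (layer p (S \<union> S')) r0"
    and "(nd p x a, nd p y b) \<in> r' \<Longrightarrow> (nd p x (a + t), nd p y (b + t)) \<in> r0"
    and "w \<in> S \<Longrightarrow> x \<in> S' \<Longrightarrow> (nd p w a, nd p x b) \<notin> r0"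
    and "spans r' (layer p S') (nd p x ` K) \<Longrightarrow> spans r0 (layer p S') ((\<lambda>f. nd p x (f + t)) ` K)"
proof -
  let ?h = "shift p t"
  have tf': "two_factor (E p) (layer p S') (map_prod ?h ?h ` r')"
    using two_factor_image[OF r' inj_on_shift[of p t S'] shift_E[OF p]] by (simp add: shift_layer[OF p])
  have "layer p (S \<union> S') = layer p S \<union> layer p S'" by auto
  then show "two_factor (E p) (layer p (S \<union> S')) r0"
    unfolding r0_def using disj by (auto intro!: two_factor_Un[OF r tf'])
  show step: "(nd p x (a + t), nd p y (b + t)) \<in> r0" if "(nd p x a, nd p y b) \<in> r'" for x a y b
    using that unfolding r0_def by (metis UnI2 map_prod_imageI shift_nd)
  show "(nd p w a, nd p x b) \<notin> r0" if "w \<in> S" "x \<in> S'"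
  proof
    assume "(nd p w a, nd p x b) \<in> r0"
    then consider "(nd p w a, nd p x b) \<in> r" | "(nd p w a, nd p x b) \<in> map_prod ?h ?h ` r'"
      unfolding r0_def Un_iff by (elim disjE)
    then have "nd p x b \<in> layer p S \<or> nd p w a \<in> layer p S'"
    proof cases
      case 1
      show ?thesis by (rule disjI1, rule SigmaD2[OF subsetD[OF two_factorD(3)[OF r] 1]])
    next
      case 2
      show ?thesis by (rule disjI2, rule SigmaD1[OF subsetD[OF two_factorD(3)[OF tf'] 2]])
    qed
    then have "x \<in> S \<or> w \<in> S'" by (simp only: nd_in_layer[OF p])
    then show False using that disj by blast
  qed
  assume sp: "spans r' (layer p S') (nd p x ` K)"
  have star: "(?h y, ?h z) \<in> r0\<^sup>*" if "(y, z) \<in> r'\<^sup>*" for y z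
    using that
  proof (induction rule: rtrancl_induct)
    case (step u v)
    then have "(?h u, ?h v) \<in> r0" unfolding r0_def by (intro UnI2 map_prod_imageI)
    then show ?case using step.IH by simp
  qed simp
  show "spans r0 (layer p S') ((\<lambda>f. nd p x (f + t)) ` K)"
    unfolding spans_def
  proof
    fix z assume "z \<in> layer p S'"
    then obtain y where y: "y \<in> layer p S'" "z = ?h y" using shift_layer[OF p, of t S'] by blast
    then obtain f where f: "f \<in> K" "(y, nd p x f) \<in> r'\<^sup>*" using sp unfolding spans_def by blast
    then show "\<exists>u\<in>(\<lambda>f. nd p x (f + t)) ` K. (z, u) \<in> r0\<^sup>*" using star[OF f(2)] y by auto
  qed
qed

text \<open>The parameters of the branch fit the octagon: gap \<open>c w\<close> provides its two
  edges over \<open>x\<close>, and distance \<open>2 * L + R\<close> keeps the windows apart. The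
  branch is rotated until all windows are clear of \<open>D\<close>.\<close>

lemma attach_unequal:
  assumes st: "state p S w b R r D F" and st': "state p S' x (c w) (2 * L + R) r' D' F'"
    and V: "w \<in> V" "x \<in> V" "w \<in> S" "x \<in> S'" and disj: "S \<inter> S' = {}"
    and rung: "\<And>a. (nd p w a, nd p x (a + s)) \<in> E p"
    and ne: "c w \<noteq> c x" and R: "0 \<le> R"
    and win: "octagon_window (c w) (c x) b R P L"
    and p: "2 * L + R < int p" "card F' * nat (2 * (L + R) + 1) * card D < p"
  shows "\<exists>r D'' F. state p (S \<union> S') w b R r D'' F \<and> card D'' \<le> card D + card F' * nat (2 * L + 1)"
proof -
  note pos = c_pos[OF V(1)] c_pos[OF V(2)]
  have p0: "0 < p" using p(2) by simp
  have tf: "two_factor (E p) (layer p S) r" and wit: "witnessed p w (c w) b r D F"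
    and spr: "spread p R F" and sp: "spans r (layer p S) (targets p w b F)"
    using st by (auto simp: state_def)
  have tf': "two_factor (E p) (layer p S') r'" and wit': "witnessed p x (c x) (c w) r' D' F'"
    and spr': "spread p (2 * L + R) F'" and sp': "spans r' (layer p S') (targets p x (c w) F')"
    using st' by (auto simp: state_def)
  have fin: "finite D" "finite F'" using witnessed_finite[OF wit] witnessed_finite[OF wit'] by simp_all
  \<comment> \<open>All offsets within \<open>L + R\<close> of the branch witnesses; one rotation
    has to clear them all.\<close>
  let ?X = "(\<lambda>(f, k). f + k) ` (F' \<times> {- (L + R)..L + R})"
  have "card ?X \<le> card F' * nat (2 * (L + R) + 1)"
    using card_image_le[of "F' \<times> {- (L + R)..L + R}" "\<lambda>(f, k). f + k"] fin
    by (simp add: card_cartesian_product)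
  then have "card ?X * card D \<le> card F' * nat (2 * (L + R) + 1) * card D" by (rule mult_right_mono) simp
  then have "card ?X * card D < p" using p(2) by (rule le_less_trans)
  then obtain \<tau> where \<tau>: "\<And>y. y \<in> ?X \<Longrightarrow> clear p D (y + \<tau>)"
    using clear_translate_exists[of ?X D p thesis] fin by auto
  define G where "G = (\<lambda>f. f + \<tau>) ` F'"
  \<comment> \<open>The offset \<open>f\<close> over \<open>x\<close> has to move to
    \<open>f + \<tau> + s\<close>, the partner of \<open>g = f + \<tau>\<close> over
    \<open>w\<close>.\<close>
  define t where "t = \<tau> + s"
  define r0 where "r0 = r \<union> map_prod (shift p t) (shift p t) ` r'"
  note un = shifted_Un[OF tf tf' disj p0 r0_def]
  have wit0: "witnessed p w (c w) b r0 D F"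
    using wit by (auto simp: witnessed_def r0_def)
  have wx: "w \<noteq> x" using V disj by auto
  have ready: "octagon_ready p w x (c w) (c x) s (L + R) r0 D g" if g: "g \<in> G" for g
  proof -
    obtain f where f: "f \<in> F'" "g = f + \<tau>" using g by (auto simp: G_def)
    have e: "(nd p x h, nd p x (h + c x)) \<in> r'" if "h = f \<or> h = f + c w" for h
      using that f(1) wit' by (auto simp: witnessed_def)
    have "(nd p x (g + s), nd p x (g + c x + s)) \<in> r0"
      using un(2)[OF e[of f]] by (simp add: t_def f(2) algebra_simps)
    moreover have "(nd p x (g + c w + s), nd p x (g + (c w + c x) + s)) \<in> r0"
      using un(2)[OF e[of "f + c w"]] by (simp add: t_def f(2) algebra_simps)
    moreover have "clear p D (g + k)" if "\<bar>k\<bar> \<le> L + R" for k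
    proof -
      have "f + k \<in> ?X" using f(1) that by force
      then show ?thesis using \<tau>[of "f + k"] by (simp add: f(2) algebra_simps)
    qed
    ultimately show ?thesis using un(3)[OF V(3,4)] by (simp add: octagon_ready_def)
  qed
  have sp0: "spans r0 (layer p S) (targets p w b F)"
    by (rule spans_mono[OF sp]) (auto simp: r0_def intro!: rtrancl_mono)
  have "spans r0 (layer p S') ((\<lambda>f. nd p x (f + t)) ` (F' \<union> (\<lambda>f. f + c w) ` F'))"
    using sp' un(4) unfolding targets_def by blast
  moreover have "(\<lambda>f. nd p x (f + t)) ` (F' \<union> (\<lambda>f. f + c w) ` F') = octagon_targets p x (c w) s G"
  proof -
    have "octagon_targets p x (c w) s G = (\<lambda>g. nd p x (g + s)) ` G \<union> (\<lambda>g. nd p x (g + c w + s)) ` G"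
      by (auto simp: octagon_targets_def)
    then show ?thesis by (simp add: G_def t_def image_Un image_image ac_simps)
  qed
  ultimately have sp1: "spans r0 (layer p (S \<union> S')) (targets p w b F \<union> octagon_targets p x (c w) s G)"
    using sp0 unfolding spans_def by fastforce
  have "card G \<le> card F'" using fin by (simp add: G_def card_image_le)
  moreover have "finite G" using fin by (simp add: G_def)
  moreover have "spread p (2 * L + R) G" unfolding G_def by (rule spread_translate[OF spr'])
  ultimately obtain r1 D1 F1 where "two_factor (E p) (layer p (S \<union> S')) r1"
    "witnessed p w (c w) b r1 D1 F1" "spread p R F1"
    "spans r1 (layer p (S \<union> S')) (targets p w b F1)" "card D1 \<le> card D + card G * nat (2 * L + 1)"
    using octagon_steps[OF sym_E rung wx pos ne R win p(1) _ un(1) wit0 spr _ _ sp1] ready by blast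
  moreover have "card G * nat (2 * L + 1) \<le> card F' * nat (2 * L + 1)"
    using \<open>card G \<le> card F'\<close> by (rule mult_right_mono) simp
  ultimately have "state p (S \<union> S') w b R r1 D1 F1" "card D1 \<le> card D + card F' * nat (2 * L + 1)"
    unfolding state_def by linarith+
  then show ?thesis by blast
qed

text \<open>Each target of the branch, \<open>f\<close> as well as \<open>f + 3 * c w\<close>, is a
  possible place for a square switch. As merging never splits a component, \<open>W\<close> and
  \<open>F\<close> are kept.\<close>

lemma attach_equal:
  assumes tf: "two_factor (E p) (layer p S) r" and wit: "witnessed p w (c w) b r D F"
    and sp: "spans r (layer p S) W"
    and st': "state p S' x (3 * c w) (4 * c w) r' D' F'"
    and V: "w \<in> V" "w \<in> S" "x \<in> S'" and disj: "S \<inter> S' = {}"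
    and rung: "\<And>a. (nd p w a, nd p x (a + s)) \<in> E p"
    and eq: "c x = c w"
    and p: "4 * c w < int p" "2 * card F' * card D < p"
  shows "\<exists>r D''. two_factor (E p) (layer p (S \<union> S')) r \<and> witnessed p w (c w) b r D'' F \<and>
    spans r (layer p (S \<union> S')) W \<and> card D'' \<le> card D + 2 * card F'"
proof -
  note pos = c_pos[OF V(1)]
  have p0: "0 < p" using p(2) by simp
  have tf': "two_factor (E p) (layer p S') r'" and wit': "witnessed p x (c w) (3 * c w) r' D' F'"
    and spr': "spread p (4 * c w) F'" and sp': "spans r' (layer p S') (targets p x (3 * c w) F')"
    using st' by (auto simp: state_def eq)
  have fin: "finite D" "finite F'" using witnessed_finite[OF wit] witnessed_finite[OF wit'] by simp_all
  define H where "H = F' \<union> (\<lambda>f. f + 3 * c w) ` F'"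
  have finH: "finite H" using fin by (simp add: H_def)
  have cardH: "card H \<le> 2 * card F'"
    using card_Un_le[of F' "(\<lambda>f. f + 3 * c w) ` F'"] card_image_le[OF fin(2), of "\<lambda>f. f + 3 * c w"]
    unfolding H_def by linarith
  have "card H * card D \<le> 2 * card F' * card D" using cardH by (rule mult_right_mono) simp
  then have "card H * card D < p" using p(2) by (rule le_less_trans)
  then obtain \<tau> where \<tau>: "\<And>y. y \<in> H \<Longrightarrow> clear p D (y + \<tau>)"
    using clear_translate_exists[of H D p thesis] fin finH by auto
  \<comment> \<open>Within a pair, a shift by at most \<open>c w\<close> leaves a difference between
    \<open>2 * c w\<close> and \<open>4 * c w\<close>, nonzero modulo \<open>p\<close>. For
    different pairs the total shift is at most \<open>4 * c w\<close>, the distance assumed of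
    \<open>F'\<close>.\<close>
  have sprH: "spread p (c w) H"
    unfolding spread_def
  proof (intro ballI impI allI)
    fix g g' k assume g: "g \<in> H" and g': "g' \<in> H" and ne: "g \<noteq> g'" and k: "\<bar>k\<bar> \<le> c w"
    obtain f i where f: "f \<in> F'" "g = f + i" "i = 0 \<or> i = 3 * c w" using g by (auto simp: H_def)
    obtain f' j where f': "f' \<in> F'" "g' = f' + j" "j = 0 \<or> j = 3 * c w" using g' by (auto simp: H_def)
    have bound: "\<bar>i + k - j\<bar> \<le> 4 * c w" using f(3) f'(3) k pos by auto
    show "(g + k) mod int p \<noteq> g' mod int p"
    proof (cases "f = f'")
      case True
      then have "i \<noteq> j" using ne f f' by auto
      then have "i + k \<noteq> j" using f(3) f'(3) k pos by auto
      then show ?thesis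
        using mod_eq_shift_iff[of "i + k" j "int p" f] bound p(1) by (simp add: True f f' add.assoc)
    next
      case False
      then have "(f + (i + k - j)) mod int p \<noteq> f' mod int p"
        using spr' f(1) f'(1) bound by (auto simp: spread_def)
      then show ?thesis
        using mod_eq_add_cancel[of "f + (i + k - j)" j "int p" f'] by (simp add: f f' algebra_simps)
    qed
  qed
  define G where "G = (\<lambda>f. f + \<tau>) ` H"
  define t where "t = \<tau> + s"
  define r0 where "r0 = r \<union> map_prod (shift p t) (shift p t) ` r'"
  note un = shifted_Un[OF tf tf' disj p0 r0_def]
  have wit0: "witnessed p w (c w) b r0 D F"
    using wit by (auto simp: witnessed_def r0_def)
  have wx: "w \<noteq> x" using V disj by auto
  have ready: "square_ready p w x (c w) s r0 D g" if g: "g \<in> G" for g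
  proof -
    obtain f where f: "f \<in> H" "g = f + \<tau>" using g by (auto simp: G_def)
    have "(nd p x f, nd p x (f + c w)) \<in> r'"
      using f(1) wit' by (auto simp: witnessed_def H_def)
    then have "(nd p x (g + s), nd p x (g + c w + s)) \<in> r0"
      using un(2) by (fastforce simp: t_def f(2) algebra_simps)
    then show ?thesis using un(3)[OF V(2,3)] \<tau>[OF f(1)] by (simp add: square_ready_def f(2))
  qed
  have sp0: "spans r0 (layer p S) W"
    by (rule spans_mono[OF sp]) (auto simp: r0_def intro!: rtrancl_mono)
  have "spans r0 (layer p S') ((\<lambda>f. nd p x (f + t)) ` H)"
    using sp' un(4) unfolding targets_def H_def by blast
  moreover have "(\<lambda>f. nd p x (f + t)) ` H = (\<lambda>g. nd p x (g + s)) ` G"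
    by (simp add: G_def t_def image_image add.assoc)
  ultimately have sp1: "spans r0 (layer p (S \<union> S')) (W \<union> (\<lambda>g. nd p x (g + s)) ` G)"
    using sp0 unfolding spans_def by fastforce
  have "card G \<le> 2 * card F'" using cardH finH card_image_le[of H "\<lambda>f. f + \<tau>"] by (simp add: G_def)
  moreover have "finite G" using finH by (simp add: G_def)
  moreover have "spread p (c w) G" unfolding G_def by (rule spread_translate[OF sprH])
  moreover have "2 * c w < int p" using p(1) pos by simp
  moreover have "nd p w a \<in> layer p S" for a using p0 V by (simp add: nd_in_layer)
  ultimately obtain r1 D1 where "two_factor (E p) (layer p (S \<union> S')) r1"
    "witnessed p w (c w) b r1 D1 F" "spans r1 (layer p (S \<union> S')) W" "card D1 \<le> card D + card G"
    using square_steps[OF sym_E rung wx pos _ _ _ un(1) wit0 _ _ sp0 sp1] ready by blast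
  then show ?thesis using \<open>card G \<le> 2 * card F'\<close>
    by (intro exI[of _ r1] exI[of _ D1]) auto
qed

section \<open>Fiber cycles as initial two-factors\<close>

lemma layer_single_nd: "z \<in> layer p {w} \<Longrightarrow> nd p w (snd z) = z"
  by (auto simp: nd_def)

definition fiber :: "nat \<Rightarrow> 'v \<Rightarrow> ('v \<times> int) rel" where
  "fiber p w = (let r = range (\<lambda>a. (nd p w a, nd p w (a + c w))) in r \<union> r\<inverse>)"

lemma fiber_iff:
  "(nd p w a, z) \<in> fiber p w \<longleftrightarrow> z = nd p w (a + c w) \<or> z = nd p w (a - c w)"
proof
  assume "(nd p w a, z) \<in> fiber p w"
  then obtain a' where "nd p w a = nd p w a' \<and> z = nd p w (a' + c w) \<or>
    z = nd p w a' \<and> nd p w a = nd p w (a' + c w)"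
    by (auto simp: fiber_def Let_def)
  then show "z = nd p w (a + c w) \<or> z = nd p w (a - c w)"
    using mod_eq_add_cancel[of a "c w" "int p" a'] mod_eq_add_cancel[of "a - c w" "c w" "int p" a']
    by (auto simp: nd_eq_iff)
next
  assume "z = nd p w (a + c w) \<or> z = nd p w (a - c w)"
  moreover have "(nd p w (a - c w), nd p w (a - c w + c w)) \<in> range (\<lambda>a. (nd p w a, nd p w (a + c w)))"
    by (rule rangeI)
  ultimately show "(nd p w a, z) \<in> fiber p w"
    by (auto simp: fiber_def Let_def)
qed

lemma sym_fiber: "sym (fiber p w)"
  by (auto simp: fiber_def Let_def sym_def)

text \<open>The bound \<open>2 * c w < int p\<close> separates the two neighbors, at distance
  \<open>c w\<close> on either side.\<close>

lemma fiber_two_factor: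
  assumes w: "w \<in> V" and p: "2 * c w < int p"
  shows "two_factor (E p) (layer p {w}) (fiber p w)"
proof -
  note pos = c_pos[OF w]
  have p0: "0 < p" using p pos by simp
  have "card (fiber p w `` {z}) = 2" if "z \<in> layer p {w}" for z
  proof -
    have z: "z = nd p w (snd z)" using layer_single_nd[OF that] by simp
    have "fiber p w `` {z} = {nd p w (snd z + c w), nd p w (snd z - c w)}"
      by (subst z) (auto simp only: Image_singleton_iff fiber_iff set_eq_iff insert_iff empty_iff)
    moreover have "nd p w (snd z + c w) \<noteq> nd p w (snd z + - c w)"
      using mod_eq_shift_iff[of "c w" "- c w" "int p" "snd z"] pos p by (simp add: nd_eq_iff)
    ultimately show ?thesis by simp
  qed
  moreover have "irrefl (fiber p w)"
    using mod_eq_shift_iff[of "c w" 0 "int p"] pos p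
    by (auto simp: irrefl_def fiber_def Let_def nd_eq_iff)
  moreover have "fiber p w \<subseteq> E p"
    using fiber_E[OF w p0] symD[OF sym_E fiber_E[OF w p0]] by (auto simp: fiber_def Let_def)
  moreover have "fiber p w \<subseteq> layer p {w} \<times> layer p {w}"
    using p0 by (auto simp: fiber_def Let_def nd_def)
  ultimately show ?thesis using sym_fiber by (simp add: two_factor_def)
qed

text \<open>\<open>k\<close> is invertible modulo \<open>p\<close>, and the Bezout coefficient
  \<open>u\<close> gives its inverse. Hence a fiber is a single cycle.\<close>

lemma multiple_mod_prime:
  assumes "prime p" "0 < k" "k < int p"
  obtains n :: nat where "int n * k mod int p = a mod int p"
proof -
  have "coprime k (int p)"
    using assms zdvd_not_zless[of k "int p"] prime_imp_coprime[of "int p" k]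
    by (simp add: coprime_commute)
  then obtain u v where uv: "u * k + v * int p = 1" using bezout_int[of k "int p"] by auto
  define n where "n = nat (a * u mod int p)"
  have "int n * k mod int p = (a * u * k) mod int p"
    using assms by (simp add: n_def mod_mult_left_eq)
  also have "a * u * k = a + (- a * v) * int p"
  proof -
    have "u * k = 1 - v * int p" using uv by simp
    then show ?thesis by (metis (no_types, lifting) mult.assoc mult.right_neutral mult_minus_left right_diff_distrib diff_conv_add_uminus)
  qed
  finally show thesis by (intro that[of n]) (simp only: mod_mult_self1)
qed

lemma fiber_connected:
  assumes w: "w \<in> V" and p: "prime p" "c w < int p" and z: "z \<in> layer p {w}"
  shows "(z, nd p w e) \<in> (fiber p w)\<^sup>*"
proof -
  obtain n where n: "int n * c w mod int p = (snd z - e) mod int p"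
    using multiple_mod_prime[OF p(1) c_pos[OF w] p(2)] by blast
  have *: "(nd p w e, nd p w (e + int m * c w)) \<in> (fiber p w)\<^sup>*" for m
  proof (induction m)
    case (Suc m)
    have "(nd p w (e + int m * c w), nd p w (e + int (Suc m) * c w)) \<in> fiber p w"
      by (simp add: fiber_iff algebra_simps)
    then show ?case using Suc by simp
  qed simp
  have "nd p w (e + int n * c w) = nd p w (snd z)"
    using mod_eq_add_cancel[of "int n * c w" e "int p" "snd z - e"] n
    by (simp add: nd_eq_iff add.commute)
  also have "\<dots> = z" by (rule layer_single_nd[OF z])
  finally have "(nd p w e, z) \<in> (fiber p w)\<^sup>*" using * by metis
  then show ?thesis using sym_rtrancl[OF sym_fiber] by (auto dest: symD)
qed

lemma fiber_edge: "(nd p w a, nd p w (a + c w)) \<in> fiber p w"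
  by (simp add: fiber_iff)

text \<open>The fiber is connected, so one witness \<open>0\<close> with its partner
  \<open>b\<close> meets all components.\<close>

lemma branch_single:
  assumes w: "w \<in> V"
  shows "branch {w} w"
  unfolding branch_def
proof (intro allI impI)
  fix b R :: int assume b: "0 < b" "b \<noteq> c w" "0 \<le> R"
  have "state p {w} w b R (fiber p w) {0, b} {0}" if p: "prime p" "nat (2 * c w) + 1 \<le> p" for p
  proof -
    have "2 * c w < int p" "c w < int p" using p(2) c_pos[OF w] by auto
    then show ?thesis
      using fiber_two_factor[OF w] fiber_connected[OF w p(1), of _ 0] fiber_edge
      by (auto simp: state_def witnessed_def spread_def spans_def targets_def)
  qed
  then show "\<exists>N B. \<forall>p\<ge>N. prime p \<longrightarrow> (\<exists>r D F. state p {w} w b R r D F \<and> card D \<le> B)" by blast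
qed

lemma connected_root_single:
  assumes w: "w \<in> V"
  shows "connected_root {w} w"
  unfolding connected_root_def
proof (intro exI allI impI conjI)
  fix p assume p: "nat (2 * c w) + 1 \<le> p" "prime p"
  then have *: "2 * c w < int p" "c w < int p" using c_pos[OF w] by auto
  show "two_factor (E p) (layer p {w}) (fiber p w)" by (rule fiber_two_factor[OF w *(1)])
  show "spans (fiber p w) (layer p {w}) {nd p w 0}"
    using fiber_connected[OF w p(2) *(2)] by (auto simp: spans_def)
  show "witnessed p w (c w) 1 (fiber p w) {} {}"
    using fiber_edge by (simp add: witnessed_def)
  show "card ({} :: int set) \<le> 0" by simp
qed

section \<open>Attaching branches with bounds uniform in \<open>p\<close>\<close>

text \<open>The child is asked for gap \<open>3 * c w\<close> and distance \<open>4 * c w\<close> if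
  the steps agree, otherwise for \<open>c w\<close> and \<open>2 * L + R\<close>. These do not
  depend on \<open>p\<close>, so the bounds of the two branches combine.\<close>

lemma branch_attach:
  assumes br: "branch S w" "branch S' x"
    and V: "w \<in> V" "x \<in> V" "w \<in> S" "x \<in> S'" and disj: "S \<inter> S' = {}" and nb: "nb w x"
  shows "branch (S \<union> S') w"
  unfolding branch_def
proof (intro allI impI)
  fix b R :: int assume b: "0 < b" "b \<noteq> c w" "0 \<le> R"
  obtain s where rung: "\<And>p a. 0 < p \<Longrightarrow> (nd p w a, nd p x (a + s)) \<in> E p"
    using rung_E[OF nb] by blast
  note pos = c_pos[OF V(1)] c_pos[OF V(2)]
  obtain N\<^sub>1 B\<^sub>1 where 1: "\<And>p. N\<^sub>1 \<le> p \<Longrightarrow> prime p \<Longrightarrow> \<exists>r D F. state p S w b R r D F \<and> card D \<le> B\<^sub>1"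
    using br(1) b unfolding branch_def by meson
  show "\<exists>N B. \<forall>p\<ge>N. prime p \<longrightarrow> (\<exists>r D F. state p (S \<union> S') w b R r D F \<and> card D \<le> B)"
  proof (cases "c w = c x")
    case True
    have "0 < 3 * c w" "3 * c w \<noteq> c x" "0 \<le> 4 * c w" using pos True by auto
    then obtain N\<^sub>2 B\<^sub>2 where 2: "\<And>p. N\<^sub>2 \<le> p \<Longrightarrow> prime p \<Longrightarrow>
        \<exists>r D F. state p S' x (3 * c w) (4 * c w) r D F \<and> card D \<le> B\<^sub>2"
      using br(2) unfolding branch_def by meson
    have "\<exists>r D F. state p (S \<union> S') w b R r D F \<and> card D \<le> B\<^sub>1 + 2 * B\<^sub>2"
      if p: "N\<^sub>1 + N\<^sub>2 + nat (4 * c w) + 2 * B\<^sub>2 * B\<^sub>1 + 1 \<le> p" "prime p" for p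
    proof -
      obtain r D F where st: "state p S w b R r D F" "card D \<le> B\<^sub>1" using 1[of p] p by auto
      obtain r' D' F' where st': "state p S' x (3 * c w) (4 * c w) r' D' F'" "card D' \<le> B\<^sub>2"
        using 2[of p] p by auto
      have F': "card F' \<le> B\<^sub>2" using st' witnessed_finite by (fastforce simp: state_def)
      then have "2 * card F' * card D \<le> 2 * B\<^sub>2 * B\<^sub>1" using st(2) by (intro mult_mono) auto
      then have p': "4 * c w < int p" "2 * card F' * card D < p" "0 < p" using p(1) by linarith+
      obtain r'' D'' where "two_factor (E p) (layer p (S \<union> S')) r''" "witnessed p w (c w) b r'' D'' F"
        "spans r'' (layer p (S \<union> S')) (targets p w b F)" "card D'' \<le> card D + 2 * card F'"
        using attach_equal[OF _ _ _ st'(1) V(1,3,4) disj rung[OF p'(3)] True[symmetric] p'(1,2)]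
          st(1) unfolding state_def by blast
      then have "state p (S \<union> S') w b R r'' D'' F" "card D'' \<le> B\<^sub>1 + 2 * B\<^sub>2"
        using st F' by (auto simp: state_def)
      then show ?thesis by blast
    qed
    then show ?thesis by blast
  next
    case False
    obtain P L where win: "octagon_window (c w) (c x) b R P L"
      using octagon_window_exists[OF pos b(1,3) False b(2)] by blast
    have L: "0 < L" using win pos by (auto simp: octagon_window_def)
    have "0 < c w" "c w \<noteq> c x" "0 \<le> 2 * L + R" using pos False L b by auto
    then obtain N\<^sub>2 B\<^sub>2 where 2: "\<And>p. N\<^sub>2 \<le> p \<Longrightarrow> prime p \<Longrightarrow>
        \<exists>r D F. state p S' x (c w) (2 * L + R) r D F \<and> card D \<le> B\<^sub>2"
      using br(2) unfolding branch_def by meson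
    have "\<exists>r D F. state p (S \<union> S') w b R r D F \<and> card D \<le> B\<^sub>1 + B\<^sub>2 * nat (2 * L + 1)"
      if p: "N\<^sub>1 + N\<^sub>2 + nat (2 * L + R) + B\<^sub>2 * nat (2 * (L + R) + 1) * B\<^sub>1 + 1 \<le> p" "prime p" for p
    proof -
      obtain r D F where st: "state p S w b R r D F" "card D \<le> B\<^sub>1" using 1[of p] p by auto
      obtain r' D' F' where st': "state p S' x (c w) (2 * L + R) r' D' F'" "card D' \<le> B\<^sub>2"
        using 2[of p] p by auto
      have F': "card F' \<le> B\<^sub>2" using st' witnessed_finite by (fastforce simp: state_def)
      then have "card F' * nat (2 * (L + R) + 1) * card D \<le> B\<^sub>2 * nat (2 * (L + R) + 1) * B\<^sub>1"
        using st(2) by (intro mult_mono) auto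
      then have p': "2 * L + R < int p" "card F' * nat (2 * (L + R) + 1) * card D < p" "0 < p"
        using p(1) by linarith+
      obtain r'' D'' F'' where "state p (S \<union> S') w b R r'' D'' F''"
        "card D'' \<le> card D + card F' * nat (2 * L + 1)"
        using attach_unequal[OF st(1) st'(1) V disj rung[OF p'(3)] False b(3) win p'(1,2)] by blast
      moreover have "card F' * nat (2 * L + 1) \<le> B\<^sub>2 * nat (2 * L + 1)" using F' by (rule mult_right_mono) simp
      ultimately have "state p (S \<union> S') w b R r'' D'' F''" "card D'' \<le> B\<^sub>1 + B\<^sub>2 * nat (2 * L + 1)"
        using st(2) by linarith+
      then show ?thesis by blast
    qed
    then show ?thesis by blast
  qed
qed

text \<open>With equal steps components only merge, so the single target at the root
  persists.\<close>

lemma connected_root_attach: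
  assumes root: "connected_root S w" and br: "branch S' x"
    and V: "w \<in> V" "w \<in> S" "x \<in> S'" and disj: "S \<inter> S' = {}" and nb: "nb w x"
    and eq: "c x = c w"
  shows "connected_root (S \<union> S') w"
proof -
  obtain s where rung: "\<And>p a. 0 < p \<Longrightarrow> (nd p w a, nd p x (a + s)) \<in> E p"
    using rung_E[OF nb] by blast
  obtain N\<^sub>1 B\<^sub>1 where 1: "\<And>p. N\<^sub>1 \<le> p \<Longrightarrow> prime p \<Longrightarrow>
      \<exists>r D. two_factor (E p) (layer p S) r \<and> witnessed p w (c w) 1 r D {} \<and>
        spans r (layer p S) {nd p w 0} \<and> card D \<le> B\<^sub>1"
    using root unfolding connected_root_def by meson
  have "0 < 3 * c w" "3 * c w \<noteq> c x" "0 \<le> 4 * c w" using c_pos[OF V(1)] eq by auto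
  then obtain N\<^sub>2 B\<^sub>2 where 2: "\<And>p. N\<^sub>2 \<le> p \<Longrightarrow> prime p \<Longrightarrow>
      \<exists>r D F. state p S' x (3 * c w) (4 * c w) r D F \<and> card D \<le> B\<^sub>2"
    using br unfolding branch_def by meson
  have "\<exists>r D. two_factor (E p) (layer p (S \<union> S')) r \<and> witnessed p w (c w) 1 r D {} \<and>
      spans r (layer p (S \<union> S')) {nd p w 0} \<and> card D \<le> B\<^sub>1 + 2 * B\<^sub>2"
    if p: "N\<^sub>1 + N\<^sub>2 + nat (4 * c w) + 2 * B\<^sub>2 * B\<^sub>1 + 1 \<le> p" "prime p" for p
  proof -
    obtain r D where r: "two_factor (E p) (layer p S) r" "witnessed p w (c w) 1 r D {}"
      "spans r (layer p S) {nd p w 0}" "card D \<le> B\<^sub>1" using 1[of p] p by auto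
    obtain r' D' F' where st': "state p S' x (3 * c w) (4 * c w) r' D' F'" "card D' \<le> B\<^sub>2"
      using 2[of p] p by auto
    have F': "card F' \<le> B\<^sub>2" using st' witnessed_finite by (fastforce simp: state_def)
    then have "2 * card F' * card D \<le> 2 * B\<^sub>2 * B\<^sub>1" using r(4) by (intro mult_mono) auto
    then have p': "4 * c w < int p" "2 * card F' * card D < p" "0 < p" using p(1) by linarith+
    obtain r'' D'' where *: "two_factor (E p) (layer p (S \<union> S')) r''" "witnessed p w (c w) 1 r'' D'' {}"
      "spans r'' (layer p (S \<union> S')) {nd p w 0}" "card D'' \<le> card D + 2 * card F'"
      using attach_equal[OF r(1-3) st'(1) V disj rung[OF p'(3)] eq p'(1,2)] by blast
    moreover have "card D'' \<le> B\<^sub>1 + 2 * B\<^sub>2" using *(4) r(4) F' by linarith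
    ultimately show ?thesis by blast
  qed
  then show ?thesis unfolding connected_root_def by blast
qed

section \<open>Decomposition into rooted branches\<close>

text \<open>An induction principle for rooted trees: the second tree is hung with its root
  \<open>x\<close> below \<open>w\<close>. The branches at the root are met along the first
  premise.\<close>

inductive built :: "'v set \<Rightarrow> 'v \<Rightarrow> bool" where
  single: "w \<in> V \<Longrightarrow> built {w} w"
| attach: "built S w \<Longrightarrow> built S' x \<Longrightarrow> S \<inter> S' = {} \<Longrightarrow> nb w x \<Longrightarrow> built (S \<union> S') w"

lemma built_subset: "built S w \<Longrightarrow> w \<in> S \<and> S \<subseteq> V"
  by (induction rule: built.induct) auto

text \<open>The new leaf \<open>x\<close> is pushed down into the part that contains
  \<open>y\<close>, so the root stays the same.\<close>

lemma built_insert: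
  assumes "built S w" "y \<in> S" "x \<in> V" "x \<notin> S" "nb y x"
  shows "built (insert x S) w"
  using assms
proof (induction rule: built.induct)
  case (single w)
  then show ?case using built.attach[OF built.single[of w] built.single[of x]] by auto
next
  case (attach S w S' z)
  show ?case
  proof (cases "y \<in> S")
    case True
    then have "built (insert x S \<union> S') w"
      using attach by (intro built.attach[of _ _ _ z]) auto
    then show ?thesis by simp
  next
    case False
    then have "built (S \<union> insert x S') w"
      using attach by (intro built.attach[of _ _ _ z]) auto
    then show ?thesis by simp
  qed
qed

text \<open>A largest built set with root \<open>v\<close> is closed under neighbors, by
  \<open>built_insert\<close>.\<close>

lemma built_connected:
  assumes fin: "finite V" and v: "v \<in> V"
    and conn: "\<And>y. y \<in> V \<Longrightarrow> (v, y) \<in> {(a, b). nb a b \<and> b \<in> V}\<^sup>*"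
  shows "built V v"
proof -
  have "card S < Suc (card V)" if "built S v" for S
    using built_subset[OF that] fin by (simp add: card_mono less_Suc_eq_le)
  then obtain S where S: "built S v" and max: "\<And>S'. built S' v \<Longrightarrow> card S' \<le> card S"
    using ex_has_greatest_nat[of "\<lambda>S. built S v" "{v}" card "Suc (card V)"] built.single[OF v] by blast
  have finS: "finite S" using built_subset[OF S] fin finite_subset by blast
  have "V \<subseteq> S"
  proof
    fix y assume "y \<in> V"
    then have "(v, y) \<in> {(a, b). nb a b \<and> b \<in> V}\<^sup>*" by (rule conn)
    then show "y \<in> S"
    proof (induction rule: rtrancl_induct)
      case base
      then show ?case using built_subset[OF S] by simp
    next
      case (step a b)
      show ?case
      proof (rule ccontr)
        assume "b \<notin> S"
        moreover from this have "built (insert b S) v" using step by (intro built_insert[OF S]) auto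
        ultimately show False using max[of "insert b S"] finS by simp
      qed
    qed
  qed
  then show ?thesis using S built_subset[OF S] by (metis subset_antisym)
qed

lemma built_branch: "built S w \<Longrightarrow> branch S w"
proof (induction rule: built.induct)
  case (single w)
  then show ?case by (rule branch_single)
next
  case (attach S w S' x)
  then show ?case using built_subset by (intro branch_attach) blast+
qed

text \<open>Along the first premise the root remains \<open>w\<close>, so every branch attached
  there has a root with the step of \<open>w\<close>. Inside the branches arbitrary steps are
  handled by \<open>built_branch\<close>.\<close>

lemma built_connected_root:
  assumes "built S w" "\<And>x. nb w x \<Longrightarrow> c x = c w"
  shows "connected_root S w"
  using assms
proof (induction rule: built.induct)
  case (single w)
  then show ?case by (simp add: connected_root_single)
next
  case (attach S w S' x)
  then show ?case
    using built_subset built_branch by (intro connected_root_attach) blast+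
qed

end

section \<open>The lift as an instance of \<open>lift_family\<close>\<close>

theorem theorem3:
  fixes T :: "('v, 'e) pre_digraph" and \<phi> :: "'e \<Rightarrow> int" and v :: 'v
  assumes "reflexive_tree T"
    and "\<forall>e \<in> loops T. \<phi> e > 0"
    and "v \<in> verts T"
    and "\<forall>u. neighbor T v u \<longrightarrow> \<phi> (loop_at T u) = \<phi> (loop_at T v)"
  shows "\<exists>N :: nat. \<forall>p \<ge> N. prime p \<longrightarrow> hamiltonian (with_proj (lift T p (voltage \<phi> p)))"
proof -
  define E where "E p = parcs (lift T p (voltage \<phi> p))" for p
  define c where "c w = \<phi> (loop_at T w)" for w
  let ?T' = "T\<lparr>arcs := arcs T - loops T\<rparr>"
  have tree: "fin_digraph ?T'" "connected ?T'"
    using assms(1) by (auto simp: reflexive_tree_def undirected_tree_def)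
  have loop: "loop_at T w \<in> loops T \<and> tail T (loop_at T w) = w" if "w \<in> verts T" for w
    unfolding loop_at_def
    by (rule theI') (use assms(1) that in \<open>auto simp: reflexive_tree_def\<close>)
  \<comment> \<open>Common source of the fiber edges, from loops, and of the matching edges, from
    neighbors.\<close>
  have dart: "(nd p (tail (dart_graph T) (e, s)) a, nd p (head (dart_graph T) (e, s)) (a + (if s then \<phi> e else - \<phi> e))) \<in> E p"
    if "e \<in> arcs T" "0 < p" for e s p a
  proof -
    have "(k mod int p) = ((a + k) mod int p - a mod int p) mod int p" for k
      by (simp add: mod_diff_eq)
    then show ?thesis
      using that unfolding E_def lift_def nd_def
      by (auto simp: dart_graph_def voltage_def intro!: bexI[of _ "(e, s)"])
  qed
  have nb_rung: "\<exists>s. \<forall>p a. 0 < p \<longrightarrow> (nd p w a, nd p x (a + s)) \<in> E p" if "neighbor T w x" for w x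
  proof -
    obtain d where "d \<in> arcs (dart_graph T)" "tail (dart_graph T) d = w" "head (dart_graph T) d = x"
      using \<open>neighbor T w x\<close> unfolding neighbor_def by (rule reachableE)
    moreover obtain e s where "d = (e, s)" by fastforce
    ultimately have "e \<in> arcs T" "tail (dart_graph T) (e, s) = w" "head (dart_graph T) (e, s) = x"
      by (auto simp: dart_graph_def)
    then show ?thesis using dart[of e _ s] by metis
  qed
  interpret lift_family "verts T" "neighbor T" c E
  proof
    show "0 < c w" if "w \<in> verts T" for w using loop[OF that] assms(2) by (simp add: c_def)
    show "sym (E p)" for p
      using symmetric_lift[of T p \<phi>] by (simp add: symmetric_def E_def)
    show "(nd p w a, nd p w (a + c w)) \<in> E p" if "w \<in> verts T" "0 < p" for w p a
    proof -
      have "loop_at T w \<in> arcs T" "tail T (loop_at T w) = w" "head T (loop_at T w) = w"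
        using loop[OF that(1)] by (auto simp: loops_def)
      then show ?thesis using dart[of "loop_at T w" p True a] that by (simp add: dart_graph_def c_def)
    qed
    show "(shift p t y, shift p t z) \<in> E p" if "0 < p" "(y, z) \<in> E p" for p y z t
    proof -
      obtain u a w b where *: "y = (u, a)" "z = (w, b)" by fastforce
      have "((b + t) mod int p - (a + t) mod int p) mod int p = (b - a) mod int p"
        by (simp add: mod_diff_eq)
      then show ?thesis using that by (auto simp: * E_def lift_def shift_def)
    qed
  qed (rule nb_rung)
  have "built (verts T) v"
  proof (rule built_connected)
    show "finite (verts T)" using fin_digraph.finite_verts[OF tree(1)] by simp
    show "v \<in> verts T" by fact
    fix y assume y: "y \<in> verts T"
    \<comment> \<open>Connectedness is given through the symmetric closure of the loopless tree;
      each of its arcs is an edge read in one of the two directions, hence a neighbor step.\<close>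
    let ?M = "mk_symmetric ?T'"
    have "v \<rightarrow>\<^sup>*\<^bsub>with_proj ?M\<^esub> y"
      using tree(2) y assms(3) by (auto simp: connected_def strongly_connected_def)
    then have "(v, y) \<in> rtrancl_on (verts T) (parcs ?M)" by (simp add: reachable_def)
    then show "(v, y) \<in> {(a, b). neighbor T a b \<and> b \<in> verts T}\<^sup>*"
    proof (induction rule: rtrancl_on_induct)
      case (step a b)
      then obtain e where e: "e \<in> arcs T" "(a = tail T e \<and> b = head T e) \<or> (a = head T e \<and> b = tail T e)"
        by (auto simp: parcs_mk_symmetric)
      have "neighbor T a b"
        unfolding neighbor_def arcs_ends_conv
        using e by (auto simp: dart_graph_def image_iff intro!: bexI[of _ e])
      then show ?case using step by (auto intro: rtrancl_into_rtrancl)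
    qed simp
  qed
  then have "connected_root (verts T) v"
    by (rule built_connected_root) (use assms(4) in \<open>auto simp: c_def\<close>)
  then obtain N where N: "\<And>p. N \<le> p \<Longrightarrow> prime p \<Longrightarrow>
      \<exists>r. two_factor (E p) (layer p (verts T)) r \<and> spans r (layer p (verts T)) {nd p v 0}"
    unfolding connected_root_def by meson
  have "hamiltonian (with_proj (lift T p (voltage \<phi> p)))" if p: "N \<le> p" "prime p" for p
  proof -
    obtain r where r: "two_factor (E p) (layer p (verts T)) r" "spans r (layer p (verts T)) {nd p v 0}"
      using N[OF p] by blast
    have V: "pverts (lift T p (voltage \<phi> p)) = layer p (verts T)" by (simp add: lift_def)
    have "nd p v 0 \<in> layer p (verts T)"
      using prime_gt_0_nat[OF p(2)] assms(3) by (simp add: nd_in_layer)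
    then show ?thesis
      using r by (intro hamiltonian_with_projI[of _ r "nd p v 0"]) (auto simp: V E_def spans_def)
  qed
  then show ?thesis by blast
qed

end
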